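(* Let $X$ be an abelian $(n,r,c)$-drackn with distinct eigenvalues $n-1>\theta>-1>\tau$, let $m_\theta,m_\tau$ be the multiplicities of $\theta,\tau$, and put $\overline{m_\theta}=m_\theta/(r-1)$, $\overline{m_\tau}=m_\tau/(r-1)$. (1) If $r$ is even, then $$-\frac12\sqrt{(n-1)\left(\sqrt{8n+1}-3\right)}\le\tau\le-\sqrt{\frac12\left(\sqrt{8n+1}+3\right)}.$$ Moreover, if the lower bound is tight, then there is a set of real equiangular lines of size $\binom{\overline{m_\tau}+1}{2}$ in dimension $\overline{m_\tau}$, and if the upper bound is tight, then there is a set of real equiangular lines of size $\binom{\overline{m_\theta}+1}{2}$ in dimension $\overline{m_\theta}$. (2) If $r$ is odd, then $$-\left(\sqrt n-1\right)\sqrt{\sqrt n+1}\le\tau\le-\sqrt{\sqrt n+1}.$$ Moreover, if the lower bound is tight, then there is a set of complex equiangular lines of size $\overline{m_\tau}^{\,2}$ in dimension $\overline{m_\tau}$, and if the upper bound is tight, then there is a set of complex equiangular lines of size $\overline{m_\theta}^{\,2}$ in dimension $\overline{m_\theta}$.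
   Context: A set of real (complex) equiangular lines in dimension $d$ is a set of lines through the origin in $\mathbb{R}^d$ (resp. $\mathbb{C}^d$) spanned by unit vectors $x_i$ such that $|\langle x_i,x_j\rangle|$ takes the same value for all $i\ne j$. An $r$-fold cover of $K_n$ is a simple graph on $rn$ vertices whose vertex set is partitioned into $n$ sets of size $r$ (fibres) such that no two vertices in the same fibre are adjacent and the edges between any two distinct fibres form a perfect matching. An $(n,r,c)$-drackn (distance-regular antipodal cover of $K_n$; $n,r\ge 2$, $c\ge 1$) is an $r$-fold cover of $K_n$ that is an antipodal distance-regular graph of diameter $3$ whose antipodal classes are the fibres, in which any two vertices at distance two have exactly $c$ common neighbours. With $\delta=n-rc-2$, its (adjacency) eigenvalues are $n-1$ (multiplicity $1$), $-1$ (multiplicity $n-1$), and $\theta=\frac{\delta+\sqrt{\delta^2+4(n-1)}}{2}>0$, $\tau=\frac{\delta-\sqrt{\delta^2+4(n-1)}}{2}<0$. An arc function of index $r$ over $K_n$ is a function $f$ from the arcs (ordered pairs of distinct vertices) of $K_n$ to $\mathrm{Sym}(r)$ with $f(v,u)=f(u,v)^{-1}$; it determines the $r$-fold cover with vertices $(u,i)$, $u\in V(K_n)$, $1\le i\le r$, in which the matching from fibre $u$ to fibre $v$ is given by the permutation $f(u,v)$. It is normalized if it is the identity on the arcs of some spanning tree of $K_n$. $\langle f\rangle$ denotes the permutation group generated by the values of $f$. A cover determined by a normalized arc function $f$ is regular if $\langle f\rangle$ acts regularly on the $r$ points, and abelian if moreover $\langle f\rangle$ is an abelian group.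
   Formalization: The lower bound on τ in (1) is claimed only when (r,c) ≠ (2,n−2): for r=2, c=n−2 (K_{n,n} minus a perfect matching, n≥3) one has θ=1, τ=−(n−1), and that bound is false (hexagon: τ=−2, bound −1). *)

theory Defs
  imports
    "Jordan_Normal_Form.Spectral_Radius"
    "Graph_Theory.Graph_Theory"
    "HOL-Algebra.Sym_Groups"
    "HOL-Library.Disjoint_Sets"
begin

text \<open>
  A finite simple graph is a \<open>pair_graph\<close> (finite, symmetric, loop-free), so every edge is
  present as two opposite arcs.
\<close>

definition nbhd :: "'a pair_pre_digraph \<Rightarrow> 'a \<Rightarrow> 'a set" where
  "nbhd X u = {w \<in> pverts X. (u, w) \<in> parcs X}"

text \<open>Only meaningful between vertices in the same component.\<close>
definition gdist :: "'a pair_pre_digraph \<Rightarrow> 'a \<Rightarrow> 'a \<Rightarrow> nat" where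
  "gdist X u v = (LEAST k. (u, v) \<in> parcs X ^^ k)"

definition gdiameter :: "'a pair_pre_digraph \<Rightarrow> nat" where
  "gdiameter X = Max {gdist X u v | u v. u \<in> pverts X \<and> v \<in> pverts X}"

definition distance_regular :: "'a pair_pre_digraph \<Rightarrow> bool" where
  "distance_regular X \<longleftrightarrow>
     pair_graph X \<and> strongly_connected (with_proj X) \<and>
     (\<exists>p :: nat \<Rightarrow> nat \<Rightarrow> nat \<Rightarrow> nat. \<forall>u \<in> pverts X. \<forall>v \<in> pverts X. \<forall>i j.
        card {w \<in> pverts X. gdist X u w = i \<and> gdist X v w = j} = p (gdist X u v) i j)"

definition antipodal_rel :: "'a pair_pre_digraph \<Rightarrow> 'a rel" where
  "antipodal_rel X =
     {(u, v) \<in> pverts X \<times> pverts X. u = v \<or> gdist X u v = gdiameter X}"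

definition antipodal :: "'a pair_pre_digraph \<Rightarrow> bool" where
  "antipodal X \<longleftrightarrow> equiv (pverts X) (antipodal_rel X)"

definition antipodal_classes :: "'a pair_pre_digraph \<Rightarrow> 'a set set" where
  "antipodal_classes X = pverts X // antipodal_rel X"

text \<open>\<open>X\<close> is an \<open>r\<close>-fold cover of \<open>K\<^sub>n\<close> with set of fibres \<open>F\<close>.\<close>
definition fold_cover :: "nat \<Rightarrow> nat \<Rightarrow> 'a pair_pre_digraph \<Rightarrow> 'a set set \<Rightarrow> bool" where
  "fold_cover n r X F \<longleftrightarrow>
     pair_graph X \<and> partition_on (pverts X) F \<and> card F = n \<and> (\<forall>A \<in> F. card A = r) \<and>
     (\<forall>A \<in> F. \<forall>u \<in> A. \<forall>v \<in> A. (u, v) \<notin> parcs X) \<and>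
     (\<forall>A \<in> F. \<forall>B \<in> F. A \<noteq> B \<longrightarrow> (\<forall>u \<in> A. \<exists>!v. v \<in> B \<and> (u, v) \<in> parcs X))"

text \<open>
  The definition admits \<open>K\<^bsub>n,n\<^esub>\<close> minus a perfect matching, for \<open>n \<ge> 3\<close>: it is the only drackn
  with \<open>r = 2\<close> and \<open>c = n - 2\<close>, and its eigenvalues are \<open>n - 1 > 1 > -1 > -(n - 1)\<close>.
\<close>
definition drackn :: "nat \<Rightarrow> nat \<Rightarrow> nat \<Rightarrow> 'a pair_pre_digraph \<Rightarrow> bool" where
  "drackn n r c X \<longleftrightarrow>
     2 \<le> n \<and> 2 \<le> r \<and> 1 \<le> c \<and>
     distance_regular X \<and> gdiameter X = 3 \<and> antipodal X \<and>
     fold_cover n r X (antipodal_classes X) \<and>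
     (\<forall>u \<in> pverts X. \<forall>v \<in> pverts X. gdist X u v = 2 \<longrightarrow> card (nbhd X u \<inter> nbhd X v) = c)"

text \<open>
  The vertices of \<open>K\<^sub>n\<close> are \<open>{1..n}\<close> and the permuted points are \<open>{1..r}\<close>, as in the
  library group \<open>sym_group r\<close>. The values \<open>f u u\<close> are irrelevant throughout.
\<close>
definition arc_function :: "nat \<Rightarrow> nat \<Rightarrow> (nat \<Rightarrow> nat \<Rightarrow> nat \<Rightarrow> nat) \<Rightarrow> bool" where
  "arc_function n r f \<longleftrightarrow>
     (\<forall>u \<in> {1..n}. \<forall>v \<in> {1..n}. u \<noteq> v \<longrightarrow>
        f u v \<in> carrier (sym_group r) \<and> f v u = inv\<^bsub>sym_group r\<^esub> (f u v))"

definition arc_cover ::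
    "nat \<Rightarrow> nat \<Rightarrow> (nat \<Rightarrow> nat \<Rightarrow> nat \<Rightarrow> nat) \<Rightarrow> (nat \<times> nat) pair_pre_digraph" where
  "arc_cover n r f =
     \<lparr> pverts = {1..n} \<times> {1..r},
       parcs = {((u, i), (v, j)) | u i v j.
          u \<in> {1..n} \<and> v \<in> {1..n} \<and> u \<noteq> v \<and> i \<in> {1..r} \<and> j \<in> {1..r} \<and> f u v i = j} \<rparr>"

text \<open>
  The library's \<open>tree\<close> only forbids directed cycles, and regards \<open>u, v, u\<close> as a cycle; on
  symmetric digraphs it is therefore not the notion of an undirected tree.
\<close>
definition undirected_tree :: "'a pair_pre_digraph \<Rightarrow> bool" where
  "undirected_tree T \<longleftrightarrow>
     pair_graph T \<and> strongly_connected (with_proj T) \<and>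
     \<not> (\<exists>p. 3 \<le> length p \<and> distinct p \<and>
           (\<forall>i < length p. (p ! i, p ! (Suc i mod length p)) \<in> parcs T))"

definition normalized :: "nat \<Rightarrow> (nat \<Rightarrow> nat \<Rightarrow> nat \<Rightarrow> nat) \<Rightarrow> bool" where
  "normalized n f \<longleftrightarrow>
     (\<exists>T. undirected_tree T \<and> pverts T = {1..n} \<and> (\<forall>(u, v) \<in> parcs T. f u v = id))"

definition arc_group :: "nat \<Rightarrow> nat \<Rightarrow> (nat \<Rightarrow> nat \<Rightarrow> nat \<Rightarrow> nat) \<Rightarrow> (nat \<Rightarrow> nat) monoid" where
  "arc_group n r f =
     subgroup_generated (sym_group r) {f u v | u v. u \<in> {1..n} \<and> v \<in> {1..n} \<and> u \<noteq> v}"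

definition acts_regularly :: "(nat \<Rightarrow> nat) monoid \<Rightarrow> nat \<Rightarrow> bool" where
  "acts_regularly G r \<longleftrightarrow>
     (\<forall>i \<in> {1..r}. \<forall>j \<in> {1..r}. \<exists>g \<in> carrier G. g i = j) \<and>
     (\<forall>g \<in> carrier G. \<forall>i \<in> {1..r}. g i = i \<longrightarrow> g = \<one>\<^bsub>G\<^esub>)"

definition abelian_drackn :: "nat \<Rightarrow> nat \<Rightarrow> nat \<Rightarrow> 'a pair_pre_digraph \<Rightarrow> bool" where
  "abelian_drackn n r c X \<longleftrightarrow>
     drackn n r c X \<and>
     (\<exists>f. arc_function n r f \<and> normalized n f \<and>
          digraph_iso (with_proj (arc_cover n r f)) (with_proj X) \<and>
          acts_regularly (arc_group n r f) r \<and> comm_group (arc_group n r f))"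

text \<open>The list \<open>vs\<close> is meant to enumerate the vertices without repetition.\<close>
definition adjacency_matrix :: "'a pair_pre_digraph \<Rightarrow> 'a list \<Rightarrow> real mat" where
  "adjacency_matrix X vs =
     mat (length vs) (length vs) (\<lambda>(i, j). if (vs ! i, vs ! j) \<in> parcs X then 1 else 0)"

definition vec_line :: "'k :: field vec \<Rightarrow> 'k vec set" where
  "vec_line x = {a \<cdot>\<^sub>v x | a. True}"

text \<open>
  \<open>L\<close> is a set of equiangular lines in dimension \<open>d\<close>, over the reals for \<open>'k = real\<close> (where
  \<open>conjugate\<close> is the identity) and over the complex numbers for \<open>'k = complex\<close>. The set \<open>S\<close>
  contains exactly one unit vector for each line.
\<close>
definition equiangular_lines ::
    "nat \<Rightarrow> 'k :: {conjugatable_field, real_normed_field} vec set set \<Rightarrow> bool" where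
  "equiangular_lines d L \<longleftrightarrow>
     (\<exists>S. S \<subseteq> {x \<in> carrier_vec d. x \<bullet>c x = 1} \<and> bij_betw vec_line S L \<and>
          (\<exists>\<alpha>. \<forall>x \<in> S. \<forall>y \<in> S. x \<noteq> y \<longrightarrow> norm (x \<bullet>c y) = \<alpha>))"

end

theory Submission
  imports Defs "HOL-Algebra.Sylow" "HOL-Algebra.Multiplicative_Group"
begin

text \<open>
  Let \<open>G\<close> be the regular abelian group of the cover and \<open>\<chi>\<close> a character of prime order, real-valued
  when \<open>r\<close> is even. Applying \<open>\<chi>\<close> to the arc function gives a Hermitian \<open>n \<times> n\<close> matrix \<open>B\<close> with zero
  diagonal, unimodular entries off the diagonal, and exactly the eigenvalues \<open>\<theta>\<close> and \<open>\<tau>\<close>. Hence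
  \<open>B - \<tau> I\<close> and \<open>\<theta> I - B\<close> are positive semidefinite Gram matrices of \<open>n\<close> equiangular lines, in dimension
  \<open>n \<tau> / (\<tau> - \<theta>)\<close> and \<open>n \<theta> / (\<theta> - \<tau>)\<close>, and the absolute bound for the number of such lines becomes the bounds
  on \<open>\<tau>\<close>. Comparing traces of powers of the adjacency matrix shows that these dimensions are the
  multiplicities divided by \<open>r - 1\<close>. The lines from \<open>\<theta> I - B\<close> are distinct only if \<open>\<theta> > 1\<close>, which fails
  precisely for \<open>r = 2\<close>, \<open>n = c + 2\<close>.
\<close>

section \<open>Equiangular lines from Hermitian matrices with two eigenvalues\<close>

text \<open>The group permutes the points of every fibre, and commutativity makes this an action on
  the cover by automorphisms. The matrix obtained from \<chi> is the adjacency operator restricted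
  to the functions that transform by \<chi> or its conjugate. As \<chi> is nontrivial, these have
  sum zero on every fibre, so only \<theta> and \<tau> can occur. The restricted matrix has trace
  zero, so each of the r - 1 nontrivial characters yields the same two dimensions: hence the
  division by r - 1. For even r a character of order 2 is real-valued, and the smaller space of
  symmetric matrices then gives the binomial bound. The lines for \<theta> bound \<tau> from above;
  the lines for \<tau> bound \<theta> from below, which becomes the lower bound on \<tau> because
  \<theta> \<tau> = -(n - 1). For r = 2 and n = c + 2 one has \<theta> = 1, the second Gram matrix
  has rank one, all its lines coincide, and the lower bound is false; only that inequality carries a
  proviso, because tightness forces \<theta> > 1.\<close>

text \<open>
  Each nonzero column of the projection yields a rank one projection that can be split off; this
  lowers the trace by one, and the trace is nonnegative.
\<close>
lemma hermitian_idempotent_gram: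
  fixes P :: "'i \<Rightarrow> 'i \<Rightarrow> complex"
  assumes "finite I"
    and "\<And>u v. u \<in> I \<Longrightarrow> v \<in> I \<Longrightarrow> P v u = cnj (P u v)"
    and "\<And>u v. u \<in> I \<Longrightarrow> v \<in> I \<Longrightarrow> (\<Sum>w\<in>I. P u w * P w v) = P u v"
  shows "\<exists>d Q. (\<forall>u\<in>I. \<forall>v\<in>I. P u v = (\<Sum>k<d. Q u k * cnj (Q v k))) \<and>
           (\<Sum>u\<in>I. P u u) = of_nat d \<and>
           ((\<forall>u\<in>I. \<forall>v\<in>I. P u v \<in> \<real>) \<longrightarrow> (\<forall>u\<in>I. \<forall>k<d. Q u k \<in> \<real>))"
  using assms(2-)
\<comment> \<open>Integrality of the trace is part of the conclusion, so the measure is its rounded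
  real part; it drops because the trace falls by one and stays nonnegative.\<close>
proof (induction "nat \<lfloor>Re (\<Sum>u\<in>I. P u u)\<rfloor>" arbitrary: P rule: less_induct)
  case less
  note herm = less.prems(1) and idem = less.prems(2)
  \<comment> \<open>A diagonal entry is the squared norm of its column. \<open>P\<close> is
    generalized because the remainder \<open>P'\<close> needs the same fact.\<close>
  have diag: "P u u = of_real (\<Sum>w\<in>I. (cmod (P w u))\<^sup>2)"
    if "u \<in> I" and "\<And>u v. u \<in> I \<Longrightarrow> v \<in> I \<Longrightarrow> P v u = cnj (P u v)"
      and "\<And>u v. u \<in> I \<Longrightarrow> v \<in> I \<Longrightarrow> (\<Sum>w\<in>I. P u w * P w v) = P u v" for P u
  proof -
    have "P u u = (\<Sum>w\<in>I. P u w * P w u)" using that(3)[OF that(1,1)] by simp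
    also have "\<dots> = (\<Sum>w\<in>I. of_real ((cmod (P w u))\<^sup>2))"
      using that(2)[OF _ that(1)] by (intro sum.cong) (simp_all add: complex_norm_square mult.commute del: of_real_power)
    finally show ?thesis by simp
  qed
  show ?case
  proof (cases "\<forall>u\<in>I. \<forall>v\<in>I. P u v = 0")
    case True
    then show ?thesis
      by (intro exI[of _ 0] exI[of _ "\<lambda>_ _. 0"]) auto
  next
    case False
    then obtain a b where ab: "a \<in> I" "b \<in> I" "P a b \<noteq> 0" by auto
    define s where "s = (\<Sum>w\<in>I. (cmod (P w b))\<^sup>2)"
    have "(cmod (P a b))\<^sup>2 \<le> s"
      unfolding s_def using ab assms(1) by (intro member_le_sum) auto
    moreover have "(cmod (P a b))\<^sup>2 > 0" using ab by simp
    ultimately have s: "s > 0" by linarith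
    define t where "t = complex_of_real (sqrt s)"
    have tt: "t * t = of_real s" and t0: "t \<noteq> 0" and ct: "cnj t = t"
      using s by (auto simp: t_def simp flip: of_real_mult)
    have Pbb: "P b b = of_real s" unfolding s_def by (rule diag[OF ab(2) herm idem])
    \<comment> \<open>The normalized column \<open>b\<close>: a unit vector fixed by
      \<open>P\<close>, so subtracting its rank one projection leaves a Hermitian
      idempotent.\<close>
    define q where "q u = P u b / t" for u
    have Pq: "(\<Sum>w\<in>I. P u w * q w) = q u" if "u \<in> I" for u
      unfolding q_def using idem[OF that ab(2)] by (simp flip: sum_divide_distrib)
    have qP: "(\<Sum>w\<in>I. cnj (q w) * P w v) = cnj (q v)" if "v \<in> I" for v
    proof -
      have "(\<Sum>w\<in>I. cnj (q w) * P w v) = cnj (\<Sum>w\<in>I. P v w * q w)"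
        using herm[OF _ that] by (auto simp: mult.commute intro!: sum.cong)
      then show ?thesis using Pq[OF that] by simp
    qed
    have qq: "(\<Sum>w\<in>I. cnj (q w) * q w) = 1"
    proof -
      have "(\<Sum>w\<in>I. cnj (q w) * q w) = (\<Sum>w\<in>I. P b w * P w b) / (t * t)"
        unfolding q_def sum_divide_distrib
        using herm[OF _ ab(2)] by (auto simp: ct intro!: sum.cong)
      then show ?thesis using idem[OF ab(2) ab(2)] Pbb s tt by simp
    qed
    define P' where "P' u v = P u v - q u * cnj (q v)" for u v
    have herm': "P' v u = cnj (P' u v)" if "u \<in> I" "v \<in> I" for u v
      using herm[OF that] by (simp add: P'_def mult.commute)
    have idem': "(\<Sum>w\<in>I. P' u w * P' w v) = P' u v" if "u \<in> I" "v \<in> I" for u v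
    proof -
      have "(\<Sum>w\<in>I. P' u w * P' w v) =
        (\<Sum>w\<in>I. P u w * P w v - (P u w * q w) * cnj (q v) - q u * (cnj (q w) * P w v)
            + q u * (cnj (q w) * q w) * cnj (q v))"
        unfolding P'_def by (intro sum.cong) (auto simp: algebra_simps)
      also have "\<dots> = (\<Sum>w\<in>I. P u w * P w v) - (\<Sum>w\<in>I. P u w * q w) * cnj (q v)
          - q u * (\<Sum>w\<in>I. cnj (q w) * P w v) + q u * (\<Sum>w\<in>I. cnj (q w) * q w) * cnj (q v)"
        by (simp add: sum.distrib sum_subtractf sum_distrib_left sum_distrib_right)
      finally show ?thesis using idem[OF that] Pq[OF that(1)] qP[OF that(2)] qq
        by (simp add: P'_def)
    qed
    have tr': "(\<Sum>u\<in>I. P' u u) = (\<Sum>u\<in>I. P u u) - 1"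
      using qq by (simp add: P'_def sum_subtractf mult.commute)
    have "(\<Sum>u\<in>I. P' u u) = of_real (\<Sum>u\<in>I. \<Sum>w\<in>I. (cmod (P' w u))\<^sup>2)"
      unfolding of_real_sum[of _ I] using diag[OF _ herm' idem'] by (intro sum.cong) auto
    then have "Re (\<Sum>u\<in>I. P' u u) \<ge> 0" by (simp add: sum_nonneg)
    then have "nat \<lfloor>Re (\<Sum>u\<in>I. P' u u)\<rfloor> < nat \<lfloor>Re (\<Sum>u\<in>I. P u u)\<rfloor>"
      unfolding tr' by (simp add: nat_less_eq_zless zless_nat_eq_int_zless)
    from less.hyps[OF this herm' idem'] obtain d Q where
      Q: "\<forall>u\<in>I. \<forall>v\<in>I. P' u v = (\<Sum>k<d. Q u k * cnj (Q v k))"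
      and d: "(\<Sum>u\<in>I. P' u u) = of_nat d"
      and re: "(\<forall>u\<in>I. \<forall>v\<in>I. P' u v \<in> \<real>) \<longrightarrow> (\<forall>u\<in>I. \<forall>k<d. Q u k \<in> \<real>)"
      by blast
    define Q' where "Q' u k = (if k < d then Q u k else q u)" for u k
    have "P u v = (\<Sum>k<Suc d. Q' u k * cnj (Q' v k))" if "u \<in> I" "v \<in> I" for u v
    proof -
      have "P u v = P' u v + q u * cnj (q v)" by (simp add: P'_def)
      also have "\<dots> = (\<Sum>k<d. Q' u k * cnj (Q' v k)) + q u * cnj (q v)"
        using Q that by (simp add: Q'_def)
      finally show ?thesis by (simp add: Q'_def)
    qed
    moreover have "(\<Sum>u\<in>I. P u u) = of_nat (Suc d)" using d tr' by (simp add: algebra_simps)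
    moreover have "Q' u k \<in> \<real>" if real: "\<forall>u\<in>I. \<forall>v\<in>I. P u v \<in> \<real>" and "u \<in> I" "k < Suc d" for u k
    proof -
      have qr: "q u \<in> \<real>" if "u \<in> I" for u
        using real that ab(2) by (auto simp: q_def t_def intro!: Reals_divide)
      then have "\<forall>u\<in>I. \<forall>v\<in>I. P' u v \<in> \<real>"
        using real by (auto simp: P'_def complex_is_Real_iff)
      then show ?thesis using re qr that by (simp add: Q'_def)
    qed
    ultimately show ?thesis by (intro exI[of _ "Suc d"] exI[of _ Q']) blast
  qed
qed

section \<open>Linear independence and the absolute bound\<close>

text \<open>Gaussian elimination: a row with a nonzero entry in column \<open>k\<close> clears this
  column from the other rows, which leaves one row and one column fewer.\<close>

lemma more_rows_than_columns_dependent: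
  fixes w :: "'i \<Rightarrow> 'k \<Rightarrow> 'f :: field"
  assumes "finite K" "finite I" "card K < card I"
  shows "\<exists>a. (\<exists>u\<in>I. a u \<noteq> 0) \<and> (\<forall>k\<in>K. (\<Sum>u\<in>I. a u * w u k) = 0)"
  using assms
proof (induction K arbitrary: I w rule: finite_induct)
  case empty
  then have "I \<noteq> {}" by auto
  then show ?case by (intro exI[of _ "\<lambda>_. 1"]) auto
next
  case (insert k K)
  show ?case
  proof (cases "\<forall>u\<in>I. w u k = 0")
    case True
    have "card K < card I" using insert by simp
    from insert.IH[OF insert.prems(1) this, of w] True show ?thesis by auto
  next
    case False
    then obtain u0 where u0: "u0 \<in> I" "w u0 k \<noteq> 0" by auto
    define J where "J = I - {u0}"
    have J: "finite J" "card K < card J" "u0 \<notin> J" "I = insert u0 J"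
      using insert u0 by (auto simp: J_def)
    define c where "c u = w u k / w u0 k" for u
    from insert.IH[OF J(1,2), of "\<lambda>u j. w u j - c u * w u0 j"] obtain a where
      a: "\<exists>u\<in>J. a u \<noteq> 0" "\<forall>j\<in>K. (\<Sum>u\<in>J. a u * (w u j - c u * w u0 j)) = 0" by blast
    \<comment> \<open>The coefficient of the pivot row \<open>u0\<close> collects the multiples of
      it that were subtracted from the other rows.\<close>
    define b where "b = a(u0 := - (\<Sum>u\<in>J. a u * c u))"
    have sum_b: "(\<Sum>u\<in>I. b u * w u j) = (\<Sum>u\<in>J. a u * (w u j - c u * w u0 j))" for j
    proof -
      have "(\<Sum>u\<in>I. b u * w u j) = b u0 * w u0 j + (\<Sum>u\<in>J. b u * w u j)"
        using J by simp
      also have "(\<Sum>u\<in>J. b u * w u j) = (\<Sum>u\<in>J. a u * w u j)"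
        using J by (intro sum.cong) (auto simp: b_def)
      finally show ?thesis
        by (simp add: b_def right_diff_distrib sum_subtractf sum_distrib_right mult.assoc)
    qed
    have "(\<Sum>u\<in>I. b u * w u k) = 0" unfolding sum_b using u0 by (simp add: c_def)
    moreover have "\<exists>u\<in>I. b u \<noteq> 0" using a(1) J(3,4) by (auto simp: b_def)
    ultimately show ?thesis using a(2) by (intro exI[of _ b]) (auto simp: sum_b)
  qed
qed

text \<open>With J the all-ones matrix, the squared moduli form
  \<open>(p^2 - s^2) I + s^2 J\<close>, which is positive definite, so its kernel is
  trivial.\<close>

lemma squared_moduli_independent:
  fixes P :: "'i \<Rightarrow> 'i \<Rightarrow> complex" and a :: "'i \<Rightarrow> complex" and s p :: real
  assumes "finite I" and "0 \<le> s" "s < p"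
    and diag: "\<And>u. u \<in> I \<Longrightarrow> cmod (P u u) = p"
    and off: "\<And>u v. u \<in> I \<Longrightarrow> v \<in> I \<Longrightarrow> u \<noteq> v \<Longrightarrow> cmod (P u v) = s"
    and zero: "\<And>v. v \<in> I \<Longrightarrow> (\<Sum>u\<in>I. a u * of_real ((cmod (P u v))\<^sup>2)) = 0"
    and "v \<in> I"
  shows "a v = 0"
proof -
  define A where "A = sum a I"
  have ps: "p\<^sup>2 - s\<^sup>2 > 0" using assms(2,3) by (simp add: power2_eq_square mult_strict_mono)
  have eq: "a v * of_real (p\<^sup>2 - s\<^sup>2) + A * of_real (s\<^sup>2) = 0" if v: "v \<in> I" for v
  proof -
    have "(\<Sum>u\<in>I. a u * of_real ((cmod (P u v))\<^sup>2)) =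
        (\<Sum>u\<in>I. (if u = v then a v * of_real (p\<^sup>2 - s\<^sup>2) else 0) + a u * of_real (s\<^sup>2))"
      using diag off v by (intro sum.cong) (auto simp: algebra_simps)
    also have "\<dots> = a v * of_real (p\<^sup>2 - s\<^sup>2) + A * of_real (s\<^sup>2)"
      using assms(1) v by (simp add: sum.distrib A_def sum_distrib_right)
    finally show ?thesis using zero[OF v] by simp
  qed
  \<comment> \<open>Adding all equations leaves a positive multiple of \<open>A\<close>; once
    \<open>A\<close> vanishes, each single equation gives \<open>a v = 0\<close>.\<close>
  have "0 = (\<Sum>v\<in>I. a v * of_real (p\<^sup>2 - s\<^sup>2) + A * of_real (s\<^sup>2))"
    using eq by simp
  also have "\<dots> = A * of_real (p\<^sup>2 - s\<^sup>2) + of_nat (card I) * (A * of_real (s\<^sup>2))"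
    unfolding sum.distrib A_def by (simp only: sum_distrib_right sum_constant)
  also have "\<dots> = A * of_real (p\<^sup>2 - s\<^sup>2 + card I * s\<^sup>2)" by (simp add: algebra_simps)
  finally have "A * of_real (p\<^sup>2 - s\<^sup>2 + card I * s\<^sup>2) = 0" by simp
  moreover have "p\<^sup>2 - s\<^sup>2 + card I * s\<^sup>2 > 0" using ps by (simp add: add_pos_nonneg)
  ultimately have "A = 0" by (metis less_irrefl mult_eq_0_iff of_real_eq_0_iff)
  then have "a v * of_real (p\<^sup>2 - s\<^sup>2) = 0" using eq[OF \<open>v \<in> I\<close>] by simp
  then show ?thesis using ps by (metis less_irrefl mult_eq_0_iff of_real_eq_0_iff)
qed

text \<open>
  The rank one matrices \<open>x\<^sub>u x\<^sub>u\<^sup>*\<close> attached to the rows \<open>x\<^sub>u\<close> of \<open>Q\<close> are linearly independent;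
  in the real case they lie in the space of symmetric matrices.
\<close>
lemma absolute_bound:
  fixes P :: "'i \<Rightarrow> 'i \<Rightarrow> complex" and Q :: "'i \<Rightarrow> nat \<Rightarrow> complex"
  assumes fin: "finite I" and sp: "0 \<le> s" "s < p"
    and diag: "\<And>u. u \<in> I \<Longrightarrow> cmod (P u u) = p"
    and off: "\<And>u v. u \<in> I \<Longrightarrow> v \<in> I \<Longrightarrow> u \<noteq> v \<Longrightarrow> cmod (P u v) = s"
    and PQ: "\<And>u v. u \<in> I \<Longrightarrow> v \<in> I \<Longrightarrow> P u v = (\<Sum>k<d. Q u k * cnj (Q v k))"
  shows "card I \<le> d\<^sup>2"
    and "(\<And>u k. u \<in> I \<Longrightarrow> k < d \<Longrightarrow> Q u k \<in> \<real>) \<Longrightarrow> card I \<le> Suc d choose 2"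
proof -
  \<comment> \<open>\<open>z\<close> says that the rank one matrices combine to zero with
    coefficients \<open>a\<close>. Taking the trace inner product with the matrix of row
    \<open>v\<close> replaces each of them by \<open>|P u v|^2\<close>.\<close>
  have key: False
    if "\<exists>u\<in>I. a u \<noteq> 0"
      and z: "\<And>j k. j < d \<Longrightarrow> k < d \<Longrightarrow> (\<Sum>u\<in>I. a u * (Q u j * cnj (Q u k))) = 0"
    for a
  proof -
    have "(\<Sum>u\<in>I. a u * of_real ((cmod (P u v))\<^sup>2)) = 0" if v: "v \<in> I" for v
    proof -
      have "a u * of_real ((cmod (P u v))\<^sup>2) =
          (\<Sum>j<d. \<Sum>k<d. a u * (Q u j * cnj (Q u k)) * (cnj (Q v j) * Q v k))" if u: "u \<in> I" for u
      proof -
        have "complex_of_real ((cmod (P u v))\<^sup>2) = P u v * cnj (P u v)"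
          by (rule complex_norm_square)
        also have "\<dots> = (\<Sum>j<d. Q u j * cnj (Q v j)) * (\<Sum>k<d. cnj (Q u k) * Q v k)"
          using PQ[OF u v] by simp
        finally show ?thesis
          unfolding sum_product by (simp add: sum_distrib_left mult_ac)
      qed
      then have "(\<Sum>u\<in>I. a u * of_real ((cmod (P u v))\<^sup>2)) =
          (\<Sum>u\<in>I. \<Sum>j<d. \<Sum>k<d. a u * (Q u j * cnj (Q u k)) * (cnj (Q v j) * Q v k))"
        by simp
      also have "\<dots> = (\<Sum>j<d. \<Sum>u\<in>I. \<Sum>k<d. a u * (Q u j * cnj (Q u k)) * (cnj (Q v j) * Q v k))"
        by (rule sum.swap)
      also have "\<dots> = (\<Sum>j<d. \<Sum>k<d. \<Sum>u\<in>I. a u * (Q u j * cnj (Q u k)) * (cnj (Q v j) * Q v k))"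
        by (intro sum.cong refl sum.swap)
      also have "\<dots> = (\<Sum>j<d. \<Sum>k<d. (\<Sum>u\<in>I. a u * (Q u j * cnj (Q u k))) * (cnj (Q v j) * Q v k))"
        by (simp add: sum_distrib_right)
      finally show ?thesis using z by simp
    qed
    from squared_moduli_independent[of I s p P a, OF fin sp diag off this]
    have "a v = 0" if "v \<in> I" for v using that by simp
    then show False using that(1) by blast
  qed
  show "card I \<le> d\<^sup>2"
  proof (rule ccontr)
    assume "\<not> card I \<le> d\<^sup>2"
    then have "card ({..<d} \<times> {..<d}) < card I" by (simp add: power2_eq_square)
    from more_rows_than_columns_dependent[OF _ fin this, of "\<lambda>u (j, k). Q u j * cnj (Q u k)"]
    show False using key by force
  qed
  assume real: "\<And>u k. u \<in> I \<Longrightarrow> k < d \<Longrightarrow> Q u k \<in> \<real>"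
  show "card I \<le> Suc d choose 2"
  proof (rule ccontr)
    \<comment> \<open>The positions on or below the diagonal, which determine a symmetric
      matrix.\<close>
    define K where "K = (SIGMA j:{..<d}. {..j})"
    have finK: "finite K" unfolding K_def by auto
    have "card K = (\<Sum>j<d. Suc j)" unfolding K_def by simp
    also have "\<dots> = Suc d choose 2"
      by (induction d) (auto simp: numeral_2_eq_2)
    finally have cardK: "card K = Suc d choose 2" .
    assume "\<not> card I \<le> Suc d choose 2"
    then have "card K < card I" using cardK by simp
    from more_rows_than_columns_dependent[OF finK fin this, of "\<lambda>u (j, k). Q u j * cnj (Q u k)"]
    obtain a where a: "\<exists>u\<in>I. a u \<noteq> 0"
      and zK: "\<And>j k. j < d \<Longrightarrow> k \<le> j \<Longrightarrow> (\<Sum>u\<in>I. a u * (Q u j * cnj (Q u k))) = 0"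
      unfolding K_def by force
    have "(\<Sum>u\<in>I. a u * (Q u j * cnj (Q u k))) = 0" if "j < d" "k < d" for j k
    proof (cases "k \<le> j")
      case False
      have "(\<Sum>u\<in>I. a u * (Q u j * cnj (Q u k))) = (\<Sum>u\<in>I. a u * (Q u k * cnj (Q u j)))"
        using real that by (intro sum.cong) (auto simp: Reals_cnj_iff)
      then show ?thesis using zK[of k j] False that by simp
    qed (use zK that in auto)
    then show False using key a by blast
  qed
qed

section \<open>Lines from Gram matrices\<close>

text \<open>Proportional unit vectors have an inner product of norm 1, so \<alpha> \<noteq> 1 keeps
  the lines distinct. \<open>norm_conj\<close> is a hypothesis because the sort does not tie the
  norm to conjugation.\<close>

lemma equiangular_linesI:
  fixes x :: "'i \<Rightarrow> 'k :: {conjugatable_field, real_normed_field} vec"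
  assumes norm_conj: "\<And>a :: 'k. norm (conjugate a) = norm a"
    and dim: "\<And>u. u \<in> I \<Longrightarrow> x u \<in> carrier_vec d"
    and unit: "\<And>u. u \<in> I \<Longrightarrow> x u \<bullet>c x u = 1"
    and ang: "\<And>u v. u \<in> I \<Longrightarrow> v \<in> I \<Longrightarrow> u \<noteq> v \<Longrightarrow> norm (x u \<bullet>c x v) = \<alpha>"
    and "\<alpha> \<noteq> 1"
  shows "equiangular_lines d (vec_line ` x ` I)" and "card (vec_line ` x ` I) = card I"
proof -
  have inj: "inj_on (vec_line \<circ> x) I"
  proof (rule inj_onI, rule ccontr)
    fix u v assume uv: "u \<in> I" "v \<in> I" "u \<noteq> v" and eq: "(vec_line \<circ> x) u = (vec_line \<circ> x) v"
    have "x u = 1 \<cdot>\<^sub>v x u" by simp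
    then have "x u \<in> vec_line (x u)" unfolding vec_line_def by blast
    then obtain a where a: "x u = a \<cdot>\<^sub>v x v" using eq by (auto simp: vec_line_def)
    have c: "x u \<bullet>c x v = a * (x v \<bullet>c x v)"
      unfolding a using dim uv by (auto simp: smult_scalar_prod_distrib[of _ d])
    have "x u \<bullet>c x u = a * conjugate a * (x v \<bullet>c x v)"
      unfolding a using dim[OF uv(2)]
      by (simp add: smult_scalar_prod_distrib[of _ d] scalar_prod_smult_distrib[of _ d] conjugate_smult_vec)
    then have "a * conjugate a = 1" using unit uv by simp
    then have "norm a * norm a = 1" using norm_conj[of a] by (metis norm_mult norm_one)
    then have "norm a = 1" using norm_ge_zero[of a] by (metis abs_norm_cancel real_sqrt_abs2 real_sqrt_one)
    then have "norm (x u \<bullet>c x v) = 1" using c unit uv by simp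
    then show False using ang[OF uv] \<open>\<alpha> \<noteq> 1\<close> by simp
  qed
  then have "bij_betw vec_line (x ` I) (vec_line ` x ` I)"
    by (intro bij_betw_imageI) (simp_all add: inj_on_imageI)
  moreover have "x ` I \<subseteq> {x \<in> carrier_vec d. x \<bullet>c x = 1}" using dim unit by auto
  moreover have "\<exists>\<alpha>. \<forall>y \<in> x ` I. \<forall>z \<in> x ` I. y \<noteq> z \<longrightarrow> norm (y \<bullet>c z) = \<alpha>"
    using ang by (intro exI[of _ \<alpha>]) auto
  ultimately show "equiangular_lines d (vec_line ` x ` I)"
    unfolding equiangular_lines_def by blast
  show "card (vec_line ` x ` I) = card I"
    using card_image[OF inj] by (simp add: image_comp)
qed

text \<open>
  \<open>B + \<phi> I\<close> is a multiple of a projection, so it is the Gram matrix of lines in a space whose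
  dimension is the multiplicity of the eigenvalue \<open>\<psi>\<close> of \<open>B\<close>.
\<close>
lemma equiangular_of_two_eigenvalues:
  fixes B :: "'i \<Rightarrow> 'i \<Rightarrow> complex" and \<phi> \<psi> :: real
  assumes fin: "finite I" and "\<phi> > 1" "\<psi> > 0"
    and diag: "\<And>u. u \<in> I \<Longrightarrow> B u u = 0"
    and herm: "\<And>u v. u \<in> I \<Longrightarrow> v \<in> I \<Longrightarrow> B v u = cnj (B u v)"
    and unim: "\<And>u v. u \<in> I \<Longrightarrow> v \<in> I \<Longrightarrow> u \<noteq> v \<Longrightarrow> cmod (B u v) = 1"
    and quad: "\<And>u v. u \<in> I \<Longrightarrow> v \<in> I \<Longrightarrow> (\<Sum>w\<in>I. B u w * B w v) =
      (if u = v then of_real (\<phi> * \<psi>) else 0) + of_real (\<psi> - \<phi>) * B u v"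
  obtains d :: nat where "real d = card I * \<phi> / (\<phi> + \<psi>)"
    and "card I \<le> d\<^sup>2"
    and "\<exists>L :: complex vec set set. equiangular_lines d L \<and> card L = card I"
    and "(\<And>u v. u \<in> I \<Longrightarrow> v \<in> I \<Longrightarrow> B u v \<in> \<real>) \<Longrightarrow> card I \<le> Suc d choose 2"
    and "(\<And>u v. u \<in> I \<Longrightarrow> v \<in> I \<Longrightarrow> B u v \<in> \<real>) \<Longrightarrow>
       \<exists>L :: real vec set set. equiangular_lines d L \<and> card L = card I"
proof -
  define \<kappa> where "\<kappa> = \<phi> + \<psi>"
  define p where "p = \<phi> / \<kappa>"
  have \<kappa>: "\<kappa> > 0" and p: "p > 0" using assms(2,3) by (auto simp: \<kappa>_def p_def)
  \<comment> \<open>By \<open>quad\<close>, \<open>(B + \<phi> I)(B - \<psi> I) = 0\<close>. Hence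
    \<open>C^2 = \<kappa> C\<close>, and \<open>P\<close> is the projection onto the eigenspace of
    \<open>B\<close> for \<psi>.\<close>
  define C where "C u v = B u v + (if u = v then of_real \<phi> else 0)" for u v
  define P where "P u v = C u v / of_real \<kappa>" for u v
  have C2: "(\<Sum>w\<in>I. C u w * C w v) = of_real \<kappa> * C u v" if uv: "u \<in> I" "v \<in> I" for u v
  proof -
    have "(\<Sum>w\<in>I. C u w * C w v) = (\<Sum>w\<in>I. B u w * B w v + (if w = v then of_real \<phi> * B u v else 0)
        + (if w = u then of_real \<phi> * B u v + (if u = v then of_real (\<phi> * \<phi>) else 0) else 0))"
      by (intro sum.cong) (auto simp: C_def algebra_simps)
    also have "\<dots> = (\<Sum>w\<in>I. B u w * B w v) + of_real \<phi> * B u v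
        + (of_real \<phi> * B u v + (if u = v then of_real (\<phi> * \<phi>) else 0))"
      using fin uv by (simp add: sum.distrib)
    finally show ?thesis unfolding quad[OF uv] by (auto simp: C_def \<kappa>_def algebra_simps)
  qed
  have hermP: "P v u = cnj (P u v)" if "u \<in> I" "v \<in> I" for u v
    using herm[OF that] by (simp add: P_def C_def)
  have idemP: "(\<Sum>w\<in>I. P u w * P w v) = P u v" if "u \<in> I" "v \<in> I" for u v
  proof -
    have "(\<Sum>w\<in>I. P u w * P w v) = (\<Sum>w\<in>I. C u w * C w v) / (of_real \<kappa> * of_real \<kappa>)"
      by (simp add: P_def sum_divide_distrib)
    then show ?thesis unfolding C2[OF that] using \<kappa> by (simp add: P_def)
  qed
  have diagP: "P u u = of_real p" if "u \<in> I" for u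
    using diag[OF that] by (simp add: P_def C_def p_def)
  have offP: "cmod (P u v) = 1 / \<kappa>" if "u \<in> I" "v \<in> I" "u \<noteq> v" for u v
    using unim[OF that] that \<kappa> by (simp add: P_def C_def norm_divide)
  from hermitian_idempotent_gram[OF fin hermP idemP] obtain d Q where
    Q: "\<And>u v. u \<in> I \<Longrightarrow> v \<in> I \<Longrightarrow> P u v = (\<Sum>k<d. Q u k * cnj (Q v k))"
    and tr: "(\<Sum>u\<in>I. P u u) = of_nat d"
    and re: "(\<forall>u\<in>I. \<forall>v\<in>I. P u v \<in> \<real>) \<longrightarrow> (\<forall>u\<in>I. \<forall>k<d. Q u k \<in> \<real>)"
    by blast
  have reQ: "Q u k \<in> \<real>" if "\<And>u v. u \<in> I \<Longrightarrow> v \<in> I \<Longrightarrow> B u v \<in> \<real>" "u \<in> I" "k < d" for u k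
  proof -
    have "\<forall>u\<in>I. \<forall>v\<in>I. P u v \<in> \<real>" using that(1) by (auto simp: P_def C_def intro!: Reals_divide Reals_add)
    then show ?thesis using re that by blast
  qed
  have "complex_of_real (card I * p) = of_real (real d)"
    using tr diagP by simp
  then have d: "real d = card I * p" using of_real_eq_iff by metis
  \<comment> \<open>The role of \<phi> > 1: it puts the off-diagonal modulus
    \<open>1 / \<kappa>\<close> strictly below the diagonal value
    \<open>\<phi> / \<kappa>\<close>.\<close>
  have sp: "0 \<le> 1 / \<kappa>" "1 / \<kappa> < p" using \<kappa> \<open>\<phi> > 1\<close> by (auto simp: p_def divide_strict_right_mono)
  have diagP': "cmod (P u u) = p" if "u \<in> I" for u using diagP[OF that] p by simp
  define t where "t = complex_of_real (sqrt p)"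
  have t: "t * t = of_real p" "t \<noteq> 0" "cnj t = t" using p by (auto simp: t_def simp flip: of_real_mult)
  have \<alpha>: "1 / \<phi> \<noteq> 1" using \<open>\<phi> > 1\<close> by simp
  have ang: "cmod (P u v / of_real p) = 1 / \<phi>" if "u \<in> I" "v \<in> I" "u \<noteq> v" for u v
    unfolding norm_divide offP[OF that] using \<kappa> \<open>\<phi> > 1\<close> by (simp add: p_def norm_divide)
  show thesis
  proof (rule that[of d])
    show "real d = card I * \<phi> / (\<phi> + \<psi>)" using d by (simp add: p_def \<kappa>_def)
    show "card I \<le> d\<^sup>2" by (rule absolute_bound(1)[of I "1 / \<kappa>" p P Q d, OF fin sp diagP' offP Q])
    show "card I \<le> Suc d choose 2" if "\<And>u v. u \<in> I \<Longrightarrow> v \<in> I \<Longrightarrow> B u v \<in> \<real>"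
      by (rule absolute_bound(2)[of I "1 / \<kappa>" p P Q d, OF fin sp diagP' offP Q reQ[OF that]])
    \<comment> \<open>Every row of \<open>Q\<close> has squared norm \<open>p\<close>, so division
      by \<open>t\<close>, a square root of \<open>p\<close>, gives unit vectors.\<close>
    define x where "x u = vec d (\<lambda>k. Q u k / t)" for u
    have ip: "x u \<bullet>c x v = P u v / of_real p" if "u \<in> I" "v \<in> I" for u v
      unfolding Q[OF that]
      by (simp add: x_def scalar_prod_def t(1,3) sum_divide_distrib lessThan_atLeast0
          flip: times_divide_times_eq)
    have "equiangular_lines d (vec_line ` x ` I) \<and> card (vec_line ` x ` I) = card I"
      using ang ip diagP p
      by (intro conjI equiangular_linesI[OF _ _ _ _ \<alpha>]) (auto simp: x_def)
    then show "\<exists>L :: complex vec set set. equiangular_lines d L \<and> card L = card I" by blast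
    show "\<exists>L :: real vec set set. equiangular_lines d L \<and> card L = card I"
      if real: "\<And>u v. u \<in> I \<Longrightarrow> v \<in> I \<Longrightarrow> B u v \<in> \<real>"
    proof -
      define y where "y u = vec d (\<lambda>k. Re (Q u k) / sqrt p)" for u
      have ip': "of_real (y u \<bullet>c y v) = P u v / of_real p" if "u \<in> I" "v \<in> I" for u v
      proof -
        have "complex_of_real (y u \<bullet>c y v) = x u \<bullet>c x v"
          using reQ[OF real that(1)] reQ[OF real that(2)] t(1) p
          by (auto simp: x_def y_def scalar_prod_def t_def Reals_cnj_iff intro!: sum.cong)
        then show ?thesis using ip[OF that] by simp
      qed
      have unit: "y u \<bullet>c y u = 1" if "u \<in> I" for u
        using ip'[OF that that] diagP[OF that] p by (simp flip: of_real_divide)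
      have ang': "norm (y u \<bullet>c y v) = 1 / \<phi>" if "u \<in> I" "v \<in> I" "u \<noteq> v" for u v
        using ip'[OF that(1,2)] ang[OF that] by (metis norm_of_real real_norm_def)
      have "equiangular_lines d (vec_line ` y ` I) \<and> card (vec_line ` y ` I) = card I"
        using unit ang' by (intro conjI equiangular_linesI[OF _ _ _ _ \<alpha>]) (auto simp: y_def)
      then show ?thesis by blast
    qed
  qed
qed

section \<open>Traces of powers and eigenvalue multiplicities\<close>

lemma sum_diag_mult_commute:
  fixes A B :: "'f :: comm_semiring_0 mat"
  assumes "A \<in> carrier_mat n m" "B \<in> carrier_mat m n"
  shows "(\<Sum>i<n. (A * B) $$ (i, i)) = (\<Sum>j<m. (B * A) $$ (j, j))"
proof -
  have "(\<Sum>i<n. (A * B) $$ (i, i)) = (\<Sum>i<n. \<Sum>j<m. A $$ (i, j) * B $$ (j, i))"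
    using assms by (intro sum.cong) (auto simp: scalar_prod_def lessThan_atLeast0)
  also have "\<dots> = (\<Sum>j<m. \<Sum>i<n. B $$ (j, i) * A $$ (i, j))"
    by (subst sum.swap) (simp add: mult.commute)
  also have "\<dots> = (\<Sum>j<m. (B * A) $$ (j, j))"
    using assms by (intro sum.cong) (auto simp: scalar_prod_def lessThan_atLeast0)
  finally show ?thesis .
qed

lemma upper_triangular_pow:
  fixes B :: "'f :: comm_ring_1 mat"
  assumes B: "B \<in> carrier_mat n n" and ut: "upper_triangular B"
  shows "upper_triangular (B ^\<^sub>m k) \<and> (\<forall>i<n. (B ^\<^sub>m k) $$ (i, i) = (B $$ (i, i)) ^ k)"
proof (induction k)
  case 0
  show ?case using B by (auto simp: upper_triangular_def)
next
  case (Suc k)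
  have Bk: "B ^\<^sub>m k \<in> carrier_mat n n" using B by simp
  have entry: "(B ^\<^sub>m k * B) $$ (i, j) = (\<Sum>l<n. (B ^\<^sub>m k) $$ (i, l) * B $$ (l, j))"
    if "i < n" "j < n" for i j
    using B Bk that by (auto simp: scalar_prod_def lessThan_atLeast0 intro!: sum.cong)
  have zero: "(B ^\<^sub>m k) $$ (i, l) * B $$ (l, j) = 0" if "i < n" "l < n" "l < i \<or> j < l" for i l j
  proof (cases "l < i")
    case True
    then have "(B ^\<^sub>m k) $$ (i, l) = 0"
      using Suc.IH upper_triangularD[of "B ^\<^sub>m k" l i] Bk B that by simp
    then show ?thesis by simp
  next
    case False
    then have "B $$ (l, j) = 0" using upper_triangularD[OF ut, of j l] B that by simp
    then show ?thesis by simp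
  qed
  have "(B ^\<^sub>m k * B) $$ (i, j) = 0" if "j < i" "i < n" for i j
    unfolding entry[OF that(2) order.strict_trans[OF that]]
    by (intro sum.neutral ballI zero) (use that in auto)
  moreover have "(B ^\<^sub>m k * B) $$ (i, i) = (B $$ (i, i)) ^ Suc k" if "i < n" for i
  proof -
    have "(B ^\<^sub>m k * B) $$ (i, i) = (\<Sum>l\<in>{i}. (B ^\<^sub>m k) $$ (i, l) * B $$ (l, i))"
      unfolding entry[OF that that] using zero that
      by (intro sum.mono_neutral_right) (auto simp: linorder_neq_iff)
    then show ?thesis using Suc.IH that by simp
  qed
  ultimately show ?case using B by (auto simp: upper_triangular_def)
qed

text \<open>Since all complex roots are real, the characteristic polynomial splits over the reals
  and a real Schur form exists. Its diagonal lists the roots with algebraic multiplicity, and powers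
  of a triangular matrix have the powers of these entries on the diagonal.\<close>

lemma char_poly_real_roots:
  fixes A :: "real mat"
  assumes A: "A \<in> carrier_mat N N"
    and real: "\<And>\<mu>. eigenvalue (map_mat complex_of_real A) \<mu> \<Longrightarrow> \<mu> \<in> \<real>"
  obtains es where "char_poly A = (\<Prod>e\<leftarrow>es. [:- e, 1:])" "length es = N"
    and "\<And>k. (\<Sum>i<N. (A ^\<^sub>m k) $$ (i, i)) = (\<Sum>e\<leftarrow>es. e ^ k)"
proof -
  interpret map_poly_hom: map_poly_inj_idom_hom "of_real :: real \<Rightarrow> complex" ..
  define C where "C = map_mat complex_of_real A"
  have C: "C \<in> carrier_mat N N" using A by (simp add: C_def)
  from char_poly_factorized[OF C] obtain as where
    as: "char_poly C = (\<Prod>a\<leftarrow>as. [:- a, 1:])" "length as = N" by blast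
  have "a \<in> \<real>" if "a \<in> set as" for a
    using real[of a] linear_poly_root[OF that] unfolding C_def[symmetric]
    by (simp add: eigenvalue_root_char_poly[OF C] as(1))
  then have "map (of_real \<circ> Re) as = as" by (intro map_idI) (auto simp: of_real_Re)
  moreover define es where "es = map Re as"
  ultimately have es: "as = map of_real es" by simp
  have "map_poly complex_of_real (char_poly A) = map_poly of_real (\<Prod>e\<leftarrow>es. [:- e, 1:])"
    using as(1) unfolding C_def of_real_hom.char_poly_hom[OF A] es
    by (simp add: map_poly_hom.hom_prod_list o_def)
  then have cp: "char_poly A = (\<Prod>e\<leftarrow>es. [:- e, 1:])" by simp
  obtain B P Q where "schur_decomposition A es = (B, P, Q)"
    by (cases "schur_decomposition A es") auto
  from schur_decomposition[OF A cp this]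
  have sim: "similar_mat_wit A B P Q" and ut: "upper_triangular B" and diag: "diag_mat B = es"
    by auto
  have mats: "B \<in> carrier_mat N N" "P \<in> carrier_mat N N" "Q \<in> carrier_mat N N" "Q * P = 1\<^sub>m N"
    using similar_mat_witD2[OF A sim] by auto
  show thesis
  proof (rule that[OF cp])
    show "length es = N" using as(2) es by simp
    show "(\<Sum>i<N. (A ^\<^sub>m k) $$ (i, i)) = (\<Sum>e\<leftarrow>es. e ^ k)" for k
    proof -
      have Bk: "B ^\<^sub>m k \<in> carrier_mat N N" using mats by simp
      have "(\<Sum>i<N. (A ^\<^sub>m k) $$ (i, i)) = (\<Sum>i<N. (P * (B ^\<^sub>m k) * Q) $$ (i, i))"
        using similar_mat_wit_pow_id[OF sim] by simp
      also have "\<dots> = (\<Sum>i<N. (Q * (P * (B ^\<^sub>m k))) $$ (i, i))"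
        using mats Bk by (intro sum_diag_mult_commute) auto
      also have "Q * (P * (B ^\<^sub>m k)) = B ^\<^sub>m k"
        using mats(4) left_mult_one_mat[OF Bk] by (simp flip: assoc_mult_mat[OF mats(3,2) Bk])
      also have "(\<Sum>i<N. (B ^\<^sub>m k) $$ (i, i)) = (\<Sum>i<N. (B $$ (i, i)) ^ k)"
        using upper_triangular_pow[OF mats(1) ut] by simp
      also have "\<dots> = (\<Sum>e\<leftarrow>es. e ^ k)"
        using mats by (simp add: diag_mat_def lessThan_atLeast0 interv_sum_list_conv_sum_set_nat o_def flip: diag)
      finally show ?thesis .
    qed
  qed
qed

lemma order_prod_linear:
  fixes es :: "'f :: idom list"
  shows "Polynomial.order x (\<Prod>e\<leftarrow>es. [:- e, 1:]) = count_list es x"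
proof (induction es)
  case (Cons e es)
  have "(\<Prod>e\<leftarrow>es. [:- e, 1:]) \<noteq> 0" by (auto simp: prod_list_zero_iff)
  then have "[:- e, 1:] * (\<Prod>e\<leftarrow>es. [:- e, 1:]) \<noteq> 0" by (simp only: mult_eq_0_iff pCons_eq_0_iff) simp
  from order_mult[OF this, of x]
  have "Polynomial.order x (\<Prod>e\<leftarrow>e # es. [:- e, 1:]) =
      Polynomial.order x [:- e, 1:] + Polynomial.order x (\<Prod>e\<leftarrow>es. [:- e, 1:])"
    by (simp only: list.map prod_list.Cons)
  then show ?case using Cons.IH by (auto simp: order_linear' )
qed (simp add: order_0I)

lemma sum_list_eq_sum_count:
  fixes f :: "'a \<Rightarrow> 'b :: semiring_1"
  assumes "finite S" "set xs \<subseteq> S"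
  shows "(\<Sum>x\<leftarrow>xs. f x) = (\<Sum>s\<in>S. of_nat (count_list xs s) * f s)"
  using assms(2)
proof (induction xs)
  case (Cons x xs)
  have "(\<Sum>s\<in>S. of_nat (count_list (x # xs) s) * f s) =
      (\<Sum>s\<in>S. (if s = x then f x else 0) + of_nat (count_list xs s) * f s)"
    by (intro sum.cong) (auto simp: distrib_right)
  also have "\<dots> = f x + (\<Sum>s\<in>S. of_nat (count_list xs s) * f s)"
    using assms(1) Cons.prems by (simp add: sum.distrib)
  finally show ?case using Cons by simp
qed simp

text \<open>\<open>N\<close> is the degree n - 1, and \<open>m0\<close>, \<open>m1\<close> belong to
  the eigenvalues \<open>N\<close> and -1. Combining three consecutive traces with the coefficients
  of z^2 - \<delta> z - N removes \<theta> and \<tau>; doing this twice gives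
  \<open>m1 = m0 * N\<close> and \<open>m0 = 1\<close>. What remains is linear in the other two
  multiplicities.\<close>

lemma multiplicities_from_traces:
  fixes N a1 \<delta> \<theta> \<tau> m0 m1 m\<^sub>\<theta> m\<^sub>\<tau> c r :: real
  assumes "N > 0" "c > 0" "r > 0"
    and \<delta>: "\<delta> = a1 - c" and N: "N = 1 + a1 + (r - 1) * c"
    and \<theta>: "\<theta>\<^sup>2 = \<delta> * \<theta> + N" and \<tau>: "\<tau>\<^sup>2 = \<delta> * \<tau> + N" and "\<theta> \<noteq> \<tau>"
    and t0: "m0 + m\<^sub>\<theta> + m1 + m\<^sub>\<tau> = (N + 1) * r"
    and t1: "m0 * N + m\<^sub>\<theta> * \<theta> - m1 + m\<^sub>\<tau> * \<tau> = 0"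
    and t2: "m0 * N\<^sup>2 + m\<^sub>\<theta> * \<theta>\<^sup>2 + m1 + m\<^sub>\<tau> * \<tau>\<^sup>2 = (N + 1) * r * N"
    and t3: "m0 * N ^ 3 + m\<^sub>\<theta> * \<theta> ^ 3 - m1 + m\<^sub>\<tau> * \<tau> ^ 3 = (N + 1) * r * N * a1"
  shows "m\<^sub>\<theta> = (N + 1) * (r - 1) * (- \<tau>) / (\<theta> - \<tau>)"
    and "m\<^sub>\<tau> = (N + 1) * (r - 1) * \<theta> / (\<theta> - \<tau>)"
proof -
  \<comment> \<open>With this identity the quadratic takes the value N r c at \<open>N\<close> and
    -r c at -1.\<close>
  have rc: "N - 1 - \<delta> = r * c" unfolding \<delta> N by (simp add: algebra_simps)
  have "N\<^sup>2 - \<delta> * N - N = N * (N - 1 - \<delta>)" by (simp add: algebra_simps power2_eq_square)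
  then have q: "N\<^sup>2 - \<delta> * N - N = N * (r * c)" "1 + \<delta> - N = - (r * c)" using rc by simp_all
  have z: "\<theta>\<^sup>2 - \<delta> * \<theta> - N = 0" "\<tau>\<^sup>2 - \<delta> * \<tau> - N = 0" using \<theta> \<tau> by simp_all
  have "m0 * (N\<^sup>2 - \<delta> * N - N) + m1 * (1 + \<delta> - N)
      + m\<^sub>\<theta> * (\<theta>\<^sup>2 - \<delta> * \<theta> - N) + m\<^sub>\<tau> * (\<tau>\<^sup>2 - \<delta> * \<tau> - N) =
    (m0 * N\<^sup>2 + m\<^sub>\<theta> * \<theta>\<^sup>2 + m1 + m\<^sub>\<tau> * \<tau>\<^sup>2) - \<delta> * (m0 * N + m\<^sub>\<theta> * \<theta> - m1 + m\<^sub>\<tau> * \<tau>)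
      - N * (m0 + m\<^sub>\<theta> + m1 + m\<^sub>\<tau>)"
    by (simp add: algebra_simps)
  also have "\<dots> = 0" unfolding t0 t1 t2 by simp
  finally have "m0 * (N * (r * c)) + m1 * (- (r * c)) = 0" unfolding q z by simp
  then have "(r * c) * (m0 * N - m1) = 0" by (simp add: algebra_simps)
  then have m1: "m1 = m0 * N" using \<open>c > 0\<close> \<open>r > 0\<close> by (simp only: mult_eq_0_iff) simp
  have "m0 * (N * (N\<^sup>2 - \<delta> * N - N)) - m1 * (1 + \<delta> - N)
      + m\<^sub>\<theta> * \<theta> * (\<theta>\<^sup>2 - \<delta> * \<theta> - N) + m\<^sub>\<tau> * \<tau> * (\<tau>\<^sup>2 - \<delta> * \<tau> - N) =
    (m0 * N ^ 3 + m\<^sub>\<theta> * \<theta> ^ 3 - m1 + m\<^sub>\<tau> * \<tau> ^ 3) - \<delta> * (m0 * N\<^sup>2 + m\<^sub>\<theta> * \<theta>\<^sup>2 + m1 + m\<^sub>\<tau> * \<tau>\<^sup>2)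
      - N * (m0 * N + m\<^sub>\<theta> * \<theta> - m1 + m\<^sub>\<tau> * \<tau>)"
    by (simp add: algebra_simps power2_eq_square power3_eq_cube)
  also have "\<dots> = (N + 1) * r * N * c" unfolding t1 t2 t3 \<delta> by (simp add: algebra_simps)
  finally have "m0 * (N * (N * (r * c))) + m1 * (r * c) = (N + 1) * r * N * c" unfolding q z by simp
  then have "((N + 1) * r * N * c) * (m0 - 1) = 0" unfolding m1 by (simp add: algebra_simps)
  then have m0: "m0 = 1" using assms(1-3) by (simp only: mult_eq_0_iff) simp
  have s: "m\<^sub>\<theta> + m\<^sub>\<tau> = (N + 1) * (r - 1)" using t0 unfolding m1 m0 by (simp add: algebra_simps)
  have w: "m\<^sub>\<theta> * \<theta> = - (m\<^sub>\<tau> * \<tau>)" using t1 unfolding m1 m0 by simp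
  have "m\<^sub>\<theta> * (\<theta> - \<tau>) = (m\<^sub>\<theta> + m\<^sub>\<tau>) * (- \<tau>)" using w by (simp add: algebra_simps)
  then show "m\<^sub>\<theta> = (N + 1) * (r - 1) * (- \<tau>) / (\<theta> - \<tau>)"
    unfolding s using \<open>\<theta> \<noteq> \<tau>\<close> by (metis eq_iff_diff_eq_0 nonzero_eq_divide_eq)
  have "m\<^sub>\<tau> * (\<theta> - \<tau>) = (m\<^sub>\<theta> + m\<^sub>\<tau>) * \<theta>" using w by (simp add: algebra_simps)
  then show "m\<^sub>\<tau> = (N + 1) * (r - 1) * \<theta> / (\<theta> - \<tau>)"
    unfolding s using \<open>\<theta> \<noteq> \<tau>\<close> by (metis eq_iff_diff_eq_0 nonzero_eq_divide_eq)
qed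

section \<open>Characters of prime order\<close>

text \<open>A nontrivial element of a subgroup of order \<open>p\<close> has the same
  \<open>p\<close>-th power as the identity. In a finite commutative group the \<open>p\<close>-th
  powers therefore form a proper subgroup.\<close>

lemma (in group) power_map_not_injective:
  assumes fin: "finite (carrier G)" and p: "prime p" and dvd: "p dvd order G"
  shows "\<not> inj_on (\<lambda>x. x [^] (p :: nat)) (carrier G)"
proof -
  obtain m where "order G = p ^ 1 * m" using dvd by auto
  from sylow_thm[OF p is_group this fin] obtain H where H: "subgroup H G" "card H = p" by auto
  have "\<one> \<in> H" using H(1) by (rule subgroup.one_closed)
  have "card H > 1" using H(2) prime_gt_1_nat[OF p] by simp
  have "H \<noteq> {\<one>}" using \<open>card H > 1\<close> by auto
  then obtain h where h: "h \<in> H" "h \<noteq> \<one>" using \<open>\<one> \<in> H\<close> by blast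
  have hG: "h \<in> carrier G" using H(1) h subgroup.mem_carrier by metis
  interpret H: group "G\<lparr>carrier := H\<rparr>" by (rule subgroup_imp_group[OF H(1)])
  have "h [^]\<^bsub>G\<lparr>carrier := H\<rparr>\<^esub> p = \<one>\<^bsub>G\<lparr>carrier := H\<rparr>\<^esub>"
    using H.pow_order_eq_1[of h] h H(2) by (simp add: order_def)
  then have "h [^] p = \<one> [^] p" using nat_pow_consistent[of h p H] by simp
  then show ?thesis using h(2) hG by (metis inj_onD one_closed)
qed

text \<open>The subgroup generated by \<open>H\<close> and \<open>x\<close>; commutativity gives it
  this explicit form, from which exponents of \<open>x\<close> can be read off.\<close>

lemma (in comm_group) adjoin_element_subgroup:
  assumes H: "subgroup H G" and x: "x \<in> carrier G"
  shows "subgroup {h \<otimes> x [^] (k :: int) |h k. h \<in> H} G"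
proof (rule subgroupI)
  note HG = subgroup.mem_carrier[OF H]
  show "{h \<otimes> x [^] (k :: int) |h k. h \<in> H} \<subseteq> carrier G" using HG x by auto
  show "{h \<otimes> x [^] (k :: int) |h k. h \<in> H} \<noteq> {}" using subgroup.one_closed[OF H] by auto
  fix a assume "a \<in> {h \<otimes> x [^] (k :: int) |h k. h \<in> H}"
  then obtain h k where a: "a = h \<otimes> x [^] (k :: int)" "h \<in> H" by blast
  have "inv a = inv h \<otimes> x [^] (- k)"
    using a HG[OF a(2)] x by (simp add: inv_mult int_pow_neg)
  then show "inv a \<in> {h \<otimes> x [^] (k :: int) |h k. h \<in> H}"
    using subgroup.m_inv_closed[OF H a(2)] by blast
  fix b assume "b \<in> {h \<otimes> x [^] (k :: int) |h k. h \<in> H}"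
  then obtain h' k' where b: "b = h' \<otimes> x [^] (k' :: int)" "h' \<in> H" by blast
  have "a \<otimes> b = (h \<otimes> h') \<otimes> x [^] (k + k')"
    using a(1) b(1) HG[OF a(2)] HG[OF b(2)] x by (simp add: int_pow_mult m_ac)
  then show "a \<otimes> b \<in> {h \<otimes> x [^] (k :: int) |h k. h \<in> H}"
    using subgroup.m_closed[OF H a(2) b(2)] by blast
qed

text \<open>
  A maximal proper subgroup containing all \<open>p\<close>-th powers has index \<open>p\<close>, so every element is
  uniquely \<open>h x\<^sup>k\<close> with \<open>h\<close> in that subgroup, \<open>x\<close> fixed outside it, and \<open>k\<close> modulo \<open>p\<close>.
\<close>
lemma (in comm_group) prime_order_character:
  assumes fin: "finite (carrier G)" and p: "prime p" and dvd: "p dvd order G"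
  obtains \<chi> :: "'a \<Rightarrow> complex"
  where "\<And>x y. x \<in> carrier G \<Longrightarrow> y \<in> carrier G \<Longrightarrow> \<chi> (x \<otimes> y) = \<chi> x * \<chi> y"
    and "\<And>x. \<chi> x ^ p = 1"
    and "\<exists>x \<in> carrier G. \<chi> x \<noteq> 1"
proof -
  define R where "R = (\<lambda>x. x [^] p) ` carrier G"
  have R_sub: "subgroup R G"
  proof (rule subgroupI)
    show "R \<subseteq> carrier G" by (auto simp: R_def)
    show "R \<noteq> {}" using one_closed by (auto simp: R_def)
    fix a assume "a \<in> R"
    then obtain x where x: "x \<in> carrier G" "a = x [^] p" by (auto simp: R_def)
    then have "inv a = (inv x) [^] p" by (simp add: nat_pow_inv)
    then show "inv a \<in> R" using x by (auto simp: R_def)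
    fix b assume "b \<in> R"
    then obtain y where y: "y \<in> carrier G" "b = y [^] p" by (auto simp: R_def)
    then have "a \<otimes> b = (x \<otimes> y) [^] p" using x by (simp add: nat_pow_distrib)
    then show "a \<otimes> b \<in> R" using x y by (auto simp: R_def)
  qed
  have "R \<noteq> carrier G"
    using power_map_not_injective[OF assms] eq_card_imp_inj_on[OF fin, of "\<lambda>x. x [^] p"]
    by (auto simp: R_def)
  define S where "S = {H. subgroup H G \<and> R \<subseteq> H \<and> H \<noteq> carrier G}"
  have "finite S"
    by (rule finite_subset[of _ "Pow (carrier G)"]) (auto simp: S_def fin dest: subgroup.mem_carrier)
  moreover have "R \<in> S" using R_sub \<open>R \<noteq> carrier G\<close> by (simp add: S_def)
  ultimately obtain H where HS: "H \<in> S" and max: "\<And>K. K \<in> S \<Longrightarrow> H \<subseteq> K \<Longrightarrow> H = K"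
    using finite_has_maximal[of S] by blast
  from HS have H: "subgroup H G" "R \<subseteq> H" "H \<noteq> carrier G" by (auto simp: S_def)
  note HG = subgroup.mem_carrier[OF H(1)]
  obtain x where x: "x \<in> carrier G" "x \<notin> H" using H HG by blast
  define K where "K = {h \<otimes> x [^] (k :: int) |h k. h \<in> H}"
  have "H \<subseteq> K"
  proof
    fix h assume "h \<in> H"
    then have "h = h \<otimes> x [^] (0 :: int)" using HG by simp
    then show "h \<in> K" using \<open>h \<in> H\<close> unfolding K_def by blast
  qed
  have "x = \<one> \<otimes> x [^] (1 :: int)" using x by simp
  then have "x \<in> K" using subgroup.one_closed[OF H(1)] unfolding K_def by blast
  have "subgroup K G" unfolding K_def by (rule adjoin_element_subgroup[OF H(1) x(1)])
  then have "K = carrier G"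
    using max[of K] \<open>H \<subseteq> K\<close> \<open>x \<in> K\<close> x(2) H(2) by (auto simp: S_def)
  have xp: "x [^] (int p) \<in> H" using x H(2) by (auto simp: R_def int_pow_int)
  \<comment> \<open>An exponent prime to \<open>p\<close> would, by Bezout, put \<open>x\<close>
    itself into \<open>H\<close>.\<close>
  have p_dvd: "int p dvd k" if k: "x [^] k \<in> H" for k :: int
  proof (rule ccontr)
    assume "\<not> int p dvd k"
    then have "coprime (int p) k" using p by (intro prime_imp_coprime) auto
    then have "coprime k (int p)" by (simp add: coprime_commute)
    then obtain u v where uv: "u * k + v * int p = 1" using bezout_int[of k "int p"] by auto
    have "x = x [^] (k * u + int p * v)" using uv x by (simp add: mult.commute)
    also have "\<dots> = (x [^] k) [^] u \<otimes> (x [^] (int p)) [^] v"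
      using x by (simp add: int_pow_mult int_pow_pow)
    finally show False
      using x(2) subgroup.m_closed[OF H(1)] subgroup_int_pow_closed[OF H(1)] k xp by metis
  qed
  \<comment> \<open>The exponent is a choice, determined only modulo \<open>p\<close>; composition
    with the \<open>p\<close>-periodic \<open>\<omega>\<close> removes the ambiguity.\<close>
  define E where "E g = (SOME k :: int. \<exists>h\<in>H. g = h \<otimes> x [^] k)" for g
  have E: "\<exists>h\<in>H. g = h \<otimes> x [^] (E g)" if "g \<in> carrier G" for g
    unfolding E_def by (rule someI_ex) (use that \<open>K = carrier G\<close>[unfolded K_def] in blast)
  have E_eq: "int p dvd E g - k" if h: "h \<in> H" "g = h \<otimes> x [^] k" for g h k
  proof -
    have "g \<in> carrier G" using h HG x by auto
    then obtain h' where h': "h' \<in> H" "g = h' \<otimes> x [^] (E g)" using E by blast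
    have "x [^] (E g) = inv h' \<otimes> g" using h' HG x by (metis inv_solve_left int_pow_closed m_closed)
    then have "x [^] (E g) = (inv h' \<otimes> h) \<otimes> x [^] k" using h h' HG x by (simp add: m_assoc)
    then have "x [^] (E g - k) = inv h' \<otimes> h"
      using h(1) h'(1) HG x by (simp add: int_pow_diff m_assoc)
    then show ?thesis
      using p_dvd subgroup.m_closed[OF H(1)] subgroup.m_inv_closed[OF H(1)] h(1) h'(1) by metis
  qed
  have p2: "p \<ge> 2" using p by (rule prime_ge_2_nat)
  define \<omega> where "\<omega> k = cis (2 * pi * (of_int k / real p))" for k :: int
  have \<omega>_add: "\<omega> (k + l) = \<omega> k * \<omega> l" for k l
    by (simp add: \<omega>_def cis_mult add_divide_distrib algebra_simps)
  have \<omega>_dvd: "\<omega> k = 1" if "int p dvd k" for k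
  proof -
    from that obtain l where "k = int p * l" by auto
    then show ?thesis using p2 unfolding \<omega>_def by (intro cis_multiple_2pi) simp
  qed
  have \<omega>_cong: "\<omega> k = \<omega> l" if "int p dvd k - l" for k l
    using \<omega>_add[of "k - l" l] \<omega>_dvd[OF that] by simp
  have "inj_on (\<lambda>k. cis (2 * pi * real k / real p)) {..<p}"
    using Complex.bij_betw_roots_unity[of p] p2 by (simp add: bij_betw_def)
  from inj_onD[OF this, of 1 0] have "\<omega> 1 \<noteq> 1" using p2 by (auto simp: \<omega>_def)
  define \<chi> where "\<chi> g = \<omega> (E g)" for g
  show thesis
  proof (rule that[of \<chi>])
    fix g g' assume g: "g \<in> carrier G" "g' \<in> carrier G"
    obtain h h' where h: "h \<in> H" "g = h \<otimes> x [^] (E g)" "h' \<in> H" "g' = h' \<otimes> x [^] (E g')"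
      using E g by meson
    have "g \<otimes> g' = (h \<otimes> x [^] (E g)) \<otimes> (h' \<otimes> x [^] (E g'))" using h by simp
    also have "\<dots> = (h \<otimes> h') \<otimes> x [^] (E g + E g')"
      using HG[OF h(1)] HG[OF h(3)] x by (simp add: int_pow_mult m_ac)
    finally have "int p dvd E (g \<otimes> g') - (E g + E g')"
      using E_eq subgroup.m_closed[OF H(1) h(1) h(3)] by blast
    from \<omega>_cong[OF this] show "\<chi> (g \<otimes> g') = \<chi> g * \<chi> g'" by (simp add: \<chi>_def \<omega>_add)
  next
    fix g
    \<comment> \<open>Outside the carrier \<open>E g\<close> is still some integer, so this holds
      for every argument.\<close>
    have "\<chi> g ^ p = \<omega> (int p * E g)"
      using p2 by (simp add: \<chi>_def \<omega>_def Complex.DeMoivre mult_ac)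
    then show "\<chi> g ^ p = 1" using \<omega>_dvd by simp
  next
    have "int p dvd E x - 1"
      using E_eq[OF subgroup.one_closed[OF H(1)], of x 1] x by simp
    from \<omega>_cong[OF this] have "\<chi> x \<noteq> 1" using \<open>\<omega> 1 \<noteq> 1\<close> by (simp add: \<chi>_def)
    then show "\<exists>x\<in>carrier G. \<chi> x \<noteq> 1" using x by blast
  qed
qed

section \<open>Spectrum of an antipodal distance-regular cover\<close>

lemma gdist_eq_0_iff:
  assumes "(u, v) \<in> (parcs X)\<^sup>*"
  shows "gdist X u v = 0 \<longleftrightarrow> u = v"
proof -
  obtain k where "(u, v) \<in> parcs X ^^ k" using assms rtrancl_imp_relpow by blast
  then have "(u, v) \<in> parcs X ^^ gdist X u v" unfolding gdist_def by (rule LeastI)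
  then show ?thesis by (metis gdist_def Least_eq_0 relpow_0_I relpow_0_E)
qed

lemma gdist_eq_1_iff:
  assumes "(u, v) \<in> (parcs X)\<^sup>*" "u \<noteq> v"
  shows "gdist X u v = 1 \<longleftrightarrow> (u, v) \<in> parcs X"
proof
  obtain k where "(u, v) \<in> parcs X ^^ k" using assms rtrancl_imp_relpow by blast
  then have "(u, v) \<in> parcs X ^^ gdist X u v" unfolding gdist_def by (rule LeastI)
  then show "gdist X u v = 1 \<Longrightarrow> (u, v) \<in> parcs X" by simp
  assume "(u, v) \<in> parcs X"
  then have "(u, v) \<in> parcs X ^^ 1" by simp
  then have "gdist X u v \<le> 1" unfolding gdist_def by (rule Least_le)
  then show "gdist X u v = 1" using gdist_eq_0_iff[OF assms(1)] assms(2) by linarith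
qed

lemma gdist_common_neighbour:
  assumes "(u, w) \<in> parcs X" "(w, v) \<in> parcs X"
  shows "gdist X u v \<le> 2"
proof -
  have "(u, v) \<in> parcs X ^^ 2" using assms by (auto simp: numeral_2_eq_2)
  then show ?thesis unfolding gdist_def by (rule Least_le)
qed

section \<open>Walks of length two in a drackn\<close>

locale drackn_graph =
  fixes n r c :: nat and X :: "'a pair_pre_digraph"
  assumes drackn: "drackn n r c X"
begin

abbreviation "V \<equiv> pverts X"
abbreviation "E \<equiv> parcs X"
abbreviation "F \<equiv> antipodal_classes X"
abbreviation "cls x \<equiv> antipodal_rel X `` {x}"

definition nb :: "'a \<Rightarrow> 'a set" where "nb x = {y \<in> V. (x, y) \<in> E}"

text \<open>By distance-regularity the number of triangles on an edge does not depend on the edge.\<close>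
definition a1 :: nat where
  "a1 = (SOME a. \<forall>x y. (x, y) \<in> E \<longrightarrow> card {z \<in> V. (x, z) \<in> E \<and> (z, y) \<in> E} = a)"

sublocale pair_graph X
  using drackn by (simp add: drackn_def distance_regular_def)

lemma n_ge_2: "2 \<le> n" and r_ge_2: "2 \<le> r" and c_ge_1: "1 \<le> c"
  using drackn by (auto simp: drackn_def)

lemma finite_V: "finite V"
  by (rule pair_finite_verts)

lemma E_sym: "(x, y) \<in> E \<longleftrightarrow> (y, x) \<in> E"
  by (auto intro: arcs_symmetric)

lemma E_in_V: "(x, y) \<in> E \<Longrightarrow> x \<in> V" "(x, y) \<in> E \<Longrightarrow> y \<in> V"
  by (auto dest: in_arcsD1 in_arcsD2)

lemma E_irrefl: "(x, y) \<in> E \<Longrightarrow> x \<noteq> y"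
  using pair_no_loops[of "(x, y)"] by simp

lemma connected:
  assumes "x \<in> V" "y \<in> V"
  shows "(x, y) \<in> E\<^sup>*"
proof -
  have "strongly_connected (with_proj X)"
    using drackn by (simp add: drackn_def distance_regular_def)
  then have "x \<rightarrow>\<^sup>*\<^bsub>with_proj X\<^esub> y" using assms by (simp add: strongly_connected_def)
  then have "(x, y) \<in> (arcs_ends (with_proj X))\<^sup>*" by (rule reachable_rtranclI)
  then show ?thesis by simp
qed

lemma equivV: "equiv V (antipodal_rel X)"
  using drackn by (simp add: drackn_def antipodal_def)

lemma cover:
  shows "partition_on V F" and "card F = n" and "A \<in> F \<Longrightarrow> card A = r"
    and "A \<in> F \<Longrightarrow> u \<in> A \<Longrightarrow> v \<in> A \<Longrightarrow> (u, v) \<notin> E"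
    and "A \<in> F \<Longrightarrow> B \<in> F \<Longrightarrow> A \<noteq> B \<Longrightarrow> u \<in> A \<Longrightarrow> \<exists>!v. v \<in> B \<and> (u, v) \<in> E"
proof -
  have fc: "fold_cover n r X F" using drackn by (simp add: drackn_def)
  show "partition_on V F" "card F = n" using fc by (simp_all add: fold_cover_def)
  have "(\<forall>A\<in>F. card A = r) \<and> (\<forall>A\<in>F. \<forall>u\<in>A. \<forall>v\<in>A. (u, v) \<notin> E) \<and>
    (\<forall>A\<in>F. \<forall>B\<in>F. A \<noteq> B \<longrightarrow> (\<forall>u\<in>A. \<exists>!v. v \<in> B \<and> (u, v) \<in> E))"
    using fc unfolding fold_cover_def by (elim conjE, intro conjI)
  then show "A \<in> F \<Longrightarrow> card A = r" "A \<in> F \<Longrightarrow> u \<in> A \<Longrightarrow> v \<in> A \<Longrightarrow> (u, v) \<notin> E"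
    "A \<in> F \<Longrightarrow> B \<in> F \<Longrightarrow> A \<noteq> B \<Longrightarrow> u \<in> A \<Longrightarrow> \<exists>!v. v \<in> B \<and> (u, v) \<in> E"
    by simp_all
qed

lemma cls_in_F: "x \<in> V \<Longrightarrow> cls x \<in> F"
  unfolding antipodal_classes_def by (rule quotientI)

lemma in_cls: "x \<in> V \<Longrightarrow> x \<in> cls x"
  using equivV by (rule equiv_class_self)

lemma F_eq_cls:
  assumes "A \<in> F" "x \<in> A"
  shows "A = cls x"
proof -
  obtain a where a: "A = cls a" using assms(1) unfolding antipodal_classes_def by (rule quotientE)
  then have "(a, x) \<in> antipodal_rel X" using assms(2) by simp
  from equiv_class_eq[OF equivV this] show ?thesis using a by simp
qed

lemma F_subset: "A \<in> F \<Longrightarrow> A \<subseteq> V"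
  using cover(1) by (auto simp: partition_on_def)

lemma finite_F: "finite F"
  using cover(2) n_ge_2 by (intro card_ge_0_finite) simp

lemma card_V: "card V = n * r"
  using sum.Union_disjoint[of F "\<lambda>_. 1 :: nat"] cover(1-3) partition_onD1[OF cover(1)]
    F_subset finite_subset[OF F_subset finite_V] partition_onD2[OF cover(1)]
  by (simp add: disjoint_def)

lemma sum_V: "sum h V = (\<Sum>A\<in>F. sum h A)"
  using sum.Union_disjoint[of F h] partition_onD1[OF cover(1)] partition_onD2[OF cover(1)]
    finite_subset[OF F_subset finite_V]
  by (simp add: disjoint_def)

lemma card_adjacent_in_fibre:
  assumes "A \<in> F" "y \<in> V"
  shows "card {x \<in> A. (x, y) \<in> E} = (if y \<in> A then 0 else 1)"
proof (cases "y \<in> A")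
  case True
  then have "{x \<in> A. (x, y) \<in> E} = {}" using cover(4)[OF assms(1)] by blast
  then show ?thesis using True by (metis card.empty)
next
  case False
  then have "cls y \<noteq> A" using in_cls[OF assms(2)] by blast
  then obtain v where "v \<in> A" "(y, v) \<in> E" "\<And>w. w \<in> A \<Longrightarrow> (y, w) \<in> E \<Longrightarrow> w = v"
    using cover(5)[OF cls_in_F[OF assms(2)] assms(1) _ in_cls[OF assms(2)]] by blast
  then have "{x \<in> A. (x, y) \<in> E} = {v}" using E_sym by blast
  then show ?thesis using False by simp
qed

text \<open>Double counting: a vertex outside the fibre \<open>A\<close> has exactly one neighbour
  in \<open>A\<close>, and a vertex of \<open>A\<close> has none.\<close>

lemma sum_over_fibres:
  fixes h :: "'a \<Rightarrow> 'b :: comm_ring_1"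
  assumes A: "A \<in> F"
  shows "(\<Sum>x\<in>A. \<Sum>y\<in>nb x. h y) = sum h V - sum h A"
proof -
  have finA: "finite A" using F_subset[OF A] finite_V finite_subset by blast
  have "(\<Sum>x\<in>A. \<Sum>y\<in>nb x. h y) = (\<Sum>x\<in>A. \<Sum>y\<in>V. if (x, y) \<in> E then h y else 0)"
    unfolding nb_def by (rule sum.cong[OF refl], rule sum.inter_filter[OF finite_V])
  also have "\<dots> = (\<Sum>y\<in>V. \<Sum>x\<in>A. if (x, y) \<in> E then h y else 0)" by (rule sum.swap)
  also have "\<dots> = (\<Sum>y\<in>V. of_nat (card {x \<in> A. (x, y) \<in> E}) * h y)"
    by (intro sum.cong refl) (simp add: finA flip: sum.inter_filter)
  also have "\<dots> = (\<Sum>y\<in>V. h y - (if y \<in> A then h y else 0))"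
    by (intro sum.cong) (auto simp: card_adjacent_in_fibre[OF A])
  also have "\<dots> = sum h V - sum h A"
    using F_subset[OF A] finite_V by (simp add: sum_subtractf Int_absorb1 flip: sum.inter_restrict)
  finally show ?thesis .
qed

lemma card_nb:
  assumes x: "x \<in> V"
  shows "card (nb x) = n - 1"
proof -
  have "card (nb x) = (\<Sum>y\<in>V. if (y, x) \<in> E then 1 else 0)"
    using finite_V by (auto simp: nb_def E_sym[of x] simp flip: sum.inter_filter)
  also have "\<dots> = (\<Sum>A\<in>F. \<Sum>y\<in>A. if (y, x) \<in> E then 1 else 0)" by (rule sum_V)
  also have "\<dots> = (\<Sum>A\<in>F. if A = cls x then 0 else 1)"
  proof (intro sum.cong refl)
    fix A assume A: "A \<in> F"
    have "finite A" using F_subset[OF A] finite_V finite_subset by blast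
    then have "(\<Sum>y\<in>A. if (y, x) \<in> E then 1 else 0) = card {y \<in> A. (y, x) \<in> E}"
      by (simp flip: sum.inter_filter)
    moreover have "x \<in> A \<longleftrightarrow> A = cls x" using F_eq_cls[OF A] in_cls[OF x] by blast
    ultimately show "(\<Sum>y\<in>A. if (y, x) \<in> E then 1 else 0) = (if A = cls x then 0 else (1 :: nat))"
      using card_adjacent_in_fibre[OF A x] by simp
  qed
  also have "\<dots> = card (F - {cls x})"
    using finite_F by (simp add: sum.If_cases Diff_eq Collect_neg_eq)
  also have "\<dots> = n - 1" using cls_in_F[OF x] cover(2) finite_F by simp
  finally show ?thesis .
qed

text \<open>Distance 1 is adjacency, so the intersection number \<open>p 1 1 1\<close> witnesses the
  choice.\<close>

lemma a1:
  assumes "(x, y) \<in> E"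
  shows "card {z \<in> V. (x, z) \<in> E \<and> (z, y) \<in> E} = a1"
proof -
  obtain p :: "nat \<Rightarrow> nat \<Rightarrow> nat \<Rightarrow> nat" where
    p: "\<And>u v i j. u \<in> V \<Longrightarrow> v \<in> V \<Longrightarrow>
        card {w \<in> V. gdist X u w = i \<and> gdist X v w = j} = p (gdist X u v) i j"
    using drackn unfolding drackn_def distance_regular_def by (elim conjE exE) simp
  have d1: "gdist X x y = 1 \<longleftrightarrow> (x, y) \<in> E" if "x \<in> V" "y \<in> V" for x y
  proof (cases "x = y")
    case True
    then show ?thesis using gdist_eq_0_iff[OF connected[OF that]] E_irrefl[of x y] by auto
  next
    case False
    then show ?thesis using gdist_eq_1_iff[OF connected[OF that]] by simp
  qed
  have "card {z \<in> V. (x, z) \<in> E \<and> (z, y) \<in> E} = p 1 1 1" if xy: "(x, y) \<in> E" for x y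
  proof -
    have V: "x \<in> V" "y \<in> V" using xy E_in_V by auto
    have "{z \<in> V. (x, z) \<in> E \<and> (z, y) \<in> E} = {w \<in> V. gdist X x w = 1 \<and> gdist X y w = 1}"
      using d1[OF V(1)] d1[OF V(2)] E_sym[of _ y] by (intro Collect_cong) auto
    then show ?thesis using p[OF V, of 1 1] d1[OF V] xy by simp
  qed
  then have "\<forall>x y. (x, y) \<in> E \<longrightarrow> card {z \<in> V. (x, z) \<in> E \<and> (z, y) \<in> E} = p 1 1 1" by simp
  then have "\<forall>x y. (x, y) \<in> E \<longrightarrow> card {z \<in> V. (x, z) \<in> E \<and> (z, y) \<in> E} = a1"
    unfolding a1_def by (rule someI)
  then show ?thesis using assms by blast
qed

lemma gdist_le_3:
  assumes "x \<in> V" "y \<in> V"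
  shows "gdist X x y \<le> 3"
proof -
  have "{gdist X u v |u v. u \<in> V \<and> v \<in> V} = (\<lambda>(u, v). gdist X u v) ` (V \<times> V)" by auto
  then have "finite {gdist X u v |u v. u \<in> V \<and> v \<in> V}" using finite_V by simp
  then have "gdist X x y \<le> Max {gdist X u v |u v. u \<in> V \<and> v \<in> V}"
    by (rule Max_ge) (use assms in blast)
  then show ?thesis using drackn by (simp add: drackn_def gdiameter_def)
qed

text \<open>The entries of the squared adjacency matrix. Antipodal vertices are at distance 3, too
  far apart for a common neighbour; every pair left over is at distance 2 because the diameter is
  3.\<close>

lemma card_common_neighbours:
  assumes V: "x \<in> V" "y \<in> V"
  shows "card {z \<in> V. (x, z) \<in> E \<and> (z, y) \<in> E} =
    (if x = y then n - 1 else if (x, y) \<in> E then a1 else if y \<in> cls x then 0 else c)"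
proof -
  have dia: "gdiameter X = 3" using drackn by (simp add: drackn_def)
  consider "x = y" | "x \<noteq> y" "(x, y) \<in> E" | "x \<noteq> y" "(x, y) \<notin> E" "y \<in> cls x"
    | "x \<noteq> y" "(x, y) \<notin> E" "y \<notin> cls x" by blast
  then show ?thesis
  proof cases
    case 1
    then have "{z \<in> V. (x, z) \<in> E \<and> (z, y) \<in> E} = nb x"
      unfolding nb_def using E_sym[of _ y] by (intro Collect_cong) auto
    then show ?thesis using 1 card_nb[OF V(1)] by simp
  next
    case 2
    then show ?thesis using a1 by simp
  next
    case 3
    then have "gdist X x y = 3" using dia by (simp add: antipodal_rel_def)
    then have "{z \<in> V. (x, z) \<in> E \<and> (z, y) \<in> E} = {}"
      using gdist_common_neighbour[of x _ X y] by fastforce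
    then have "card {z \<in> V. (x, z) \<in> E \<and> (z, y) \<in> E} = 0" by (metis card.empty)
    then show ?thesis using 3 by simp
  next
    case 4
    have "gdist X x y \<noteq> 0" "gdist X x y \<noteq> 1"
      using 4 gdist_eq_0_iff gdist_eq_1_iff connected[OF V] by metis+
    moreover have "gdist X x y \<noteq> 3" using 4 V dia by (simp add: antipodal_rel_def)
    ultimately have "gdist X x y = 2" using gdist_le_3[OF V] by linarith
    then have "card (nbhd X x \<inter> nbhd X y) = c" using drackn V by (simp add: drackn_def)
    moreover have "nbhd X x \<inter> nbhd X y = {z \<in> V. (x, z) \<in> E \<and> (z, y) \<in> E}"
      unfolding nbhd_def using E_sym[of y] by auto
    ultimately show ?thesis using 4 by simp
  qed
qed

lemma nb_disjoint_cls: "x \<in> V \<Longrightarrow> nb x \<inter> cls x = {}"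
  using cover(4)[OF cls_in_F _ _] in_cls by (auto simp: nb_def)

text \<open>Expresses the squared adjacency operator through the identity, adjacency, fibre sums and
  the total sum. Where the last two vanish, it is a quadratic relation with linear coefficient
  \<open>a1 - c\<close>.\<close>

lemma sum_two_steps:
  fixes h :: "'a \<Rightarrow> 'b :: comm_ring_1"
  assumes x: "x \<in> V"
  shows "(\<Sum>y\<in>nb x. \<Sum>z\<in>nb y. h z) =
    of_nat (n - 1) * h x + of_nat a1 * sum h (nb x) + of_nat c * (sum h V - sum h (cls x) - sum h (nb x))"
proof -
  have sub: "nb x \<subseteq> V" "cls x \<subseteq> V" using F_subset[OF cls_in_F[OF x]] by (auto simp: nb_def)
  have restrict: "(\<Sum>z\<in>V. if z \<in> A then g z else 0) = sum g A"
    if "A \<subseteq> V" for A and g :: "'a \<Rightarrow> 'b"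
    using finite_V that by (simp add: Int_absorb1 flip: sum.inter_restrict)
  have "(\<Sum>y\<in>nb x. \<Sum>z\<in>nb y. h z) = (\<Sum>y\<in>V. \<Sum>z\<in>V. if (x, y) \<in> E \<and> (y, z) \<in> E then h z else 0)"
    unfolding nb_def sum.inter_filter[OF finite_V]
    by (intro sum.cong refl) auto
  also have "\<dots> = (\<Sum>z\<in>V. \<Sum>y\<in>V. if (x, y) \<in> E \<and> (y, z) \<in> E then h z else 0)"
    by (rule sum.swap)
  also have "\<dots> = (\<Sum>z\<in>V. of_nat (card {y \<in> V. (x, y) \<in> E \<and> (y, z) \<in> E}) * h z)"
    by (intro sum.cong refl) (simp add: finite_V flip: sum.inter_filter)
  also have "\<dots> = (\<Sum>z\<in>V. (if z = x then of_nat (n - 1) * h z else 0)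
      + (if z \<in> nb x then of_nat a1 * h z else 0)
      + of_nat c * (h z - (if z \<in> cls x then h z else 0) - (if z \<in> nb x then h z else 0)))"
    using nb_disjoint_cls[OF x] in_cls[OF x] E_irrefl
    by (intro sum.cong refl) (auto simp: card_common_neighbours[OF x] nb_def)
  also have "\<dots> = of_nat (n - 1) * h x + of_nat a1 * sum h (nb x)
      + of_nat c * (sum h V - sum h (cls x) - sum h (nb x))"
    unfolding sum.distrib sum_distrib_left[symmetric] sum_subtractf restrict[OF sub(1)] restrict[OF sub(2)]
    using finite_V x by simp
  finally show ?thesis .
qed

text \<open>The constant function 1 counts the walks of length two from a vertex, and cancelling
  \<open>n - 1\<close> leaves this relation. It identifies \<open>a1 - c\<close> with \<delta> = n -
  r c - 2.\<close>

lemma parameters: "n = a1 + (r - 1) * c + 2"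
proof -
  obtain x where x: "x \<in> V" using card_V n_ge_2 r_ge_2 by fastforce
  have nb: "card (nb y) = n - 1" if "y \<in> nb x" for y using card_nb that by (simp add: nb_def)
  have "int (n - 1) * int (n - 1) =
    int (n - 1) + int a1 * int (n - 1) + int c * (int (n * r) - int r - int (n - 1))"
    using sum_two_steps[OF x, of "\<lambda>_. 1 :: int"] nb card_nb[OF x] card_V cover(3)[OF cls_in_F[OF x]]
    by simp
  moreover have "int (n * r) - int r - int (n - 1) = int (n - 1) * int (r - 1)"
    using n_ge_2 r_ge_2 by (simp add: of_nat_diff algebra_simps)
  ultimately have "int (n - 1) * int (n - 1) = int (n - 1) * (1 + int a1 + int c * int (r - 1))"
    by (simp add: algebra_simps)
  then have "int (n - 1) = 1 + int a1 + int c * int (r - 1)" using n_ge_2 by simp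
  also have "\<dots> = int (1 + a1 + c * (r - 1))" by simp
  finally have "n - 1 = 1 + a1 + c * (r - 1)" using of_nat_eq_iff by blast
  then show ?thesis using n_ge_2 by (simp add: mult.commute)
qed

text \<open>
  If \<open>ev\<close> is neither \<open>n - 1\<close> nor \<open>-1\<close>, then the sums of \<open>h\<close> over the fibres vanish, and counting
  walks of length two leaves a quadratic equation.
\<close>
lemma eigenfunction:
  fixes h :: "'a \<Rightarrow> complex"
  assumes eig: "\<And>x. x \<in> V \<Longrightarrow> sum h (nb x) = ev * h x" and "x \<in> V" "h x \<noteq> 0"
  shows "ev = of_nat n - 1 \<or> ev = -1 \<or> ev\<^sup>2 = (of_nat a1 - of_nat c) * ev + (of_nat n - 1)"
proof (rule ccontr)
  assume neg: "\<not> ?thesis"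
  \<comment> \<open>Sums the eigenvalue equation over a fibre. Adding over all fibres makes the
    total sum zero unless \<open>ev\<close> is \<open>n - 1\<close>; then every fibre sum is zero
    unless \<open>ev\<close> is -1.\<close>
  have fibre: "ev * sum h A = sum h V - sum h A" if A: "A \<in> F" for A
  proof -
    have "(\<Sum>x\<in>A. \<Sum>y\<in>nb x. h y) = ev * sum h A"
      using eig F_subset[OF A] by (auto simp: sum_distrib_left intro!: sum.cong)
    then show ?thesis using sum_over_fibres[OF A, of h] by simp
  qed
  have "ev * sum h V = (\<Sum>A\<in>F. ev * sum h A)" unfolding sum_V[of h] by (rule sum_distrib_left)
  also have "\<dots> = (\<Sum>A\<in>F. sum h V - sum h A)" using fibre by simp
  also have "\<dots> = of_nat n * sum h V - sum h V"
    using cover(2) sum_V[of h] by (simp add: sum_subtractf)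
  finally have "(ev - (of_nat n - 1)) * sum h V = 0" by (simp add: algebra_simps)
  then have V0: "sum h V = 0" using neg by simp
  have "(ev + 1) * sum h (cls x) = 0"
    using fibre[OF cls_in_F[OF \<open>x \<in> V\<close>]] V0 by (simp add: algebra_simps)
  moreover have "ev + 1 \<noteq> 0" using neg by (simp add: add_eq_0_iff2)
  ultimately have cls0: "sum h (cls x) = 0" by simp
  have "(\<Sum>y\<in>nb x. \<Sum>z\<in>nb y. h z) = ev * sum h (nb x)"
    unfolding sum_distrib_left using eig by (intro sum.cong refl) (simp add: nb_def)
  then have "ev * (ev * h x) = of_nat (n - 1) * h x + of_nat a1 * (ev * h x) + of_nat c * (- (ev * h x))"
    unfolding sum_two_steps[OF \<open>x \<in> V\<close>] V0 cls0 eig[OF \<open>x \<in> V\<close>] by simp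
  then have "(ev\<^sup>2 - (of_nat a1 - of_nat c) * ev - (of_nat n - 1)) * h x = 0"
    using n_ge_2 by (simp add: algebra_simps power2_eq_square of_nat_diff)
  then have "ev\<^sup>2 - (of_nat a1 - of_nat c) * ev - (of_nat n - 1) = 0"
    using \<open>h x \<noteq> 0\<close> by (metis mult_eq_0_iff)
  then have "ev\<^sup>2 = (of_nat a1 - of_nat c) * ev + (of_nat n - 1)" by (metis diff_diff_eq eq_iff_diff_eq_0)
  then show False using neg by blast
qed

section \<open>Eigenvalues, traces and multiplicities of the adjacency matrix\<close>

context
  fixes vs :: "'a list"
  assumes vs: "distinct vs" "set vs = V"
begin

lemma length_vs: "length vs = n * r"
  using distinct_card[OF vs(1)] vs(2) card_V by simp

lemma sum_vs: "(\<Sum>i<length vs. h (vs ! i)) = sum h V"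
  using sum.reindex_bij_betw[OF bij_betw_nth[OF vs(1) refl vs(2)[symmetric]], of h] by simp

lemma vs_V: "i < length vs \<Longrightarrow> vs ! i \<in> V"
  using vs(2) nth_mem by blast

lemma adjacency_eigenvalue:
  assumes "eigenvalue (map_mat complex_of_real (adjacency_matrix X vs)) ev"
  shows "ev = of_nat n - 1 \<or> ev = -1 \<or> ev\<^sup>2 = (of_nat a1 - of_nat c) * ev + (of_nat n - 1)"
proof -
  define A where "A = map_mat complex_of_real (adjacency_matrix X vs)"
  have dimA: "dim_row A = length vs" "dim_col A = length vs"
    by (simp_all add: A_def adjacency_matrix_def)
  obtain v where "eigenvector A v ev"
    using assms unfolding A_def[symmetric] eigenvalue_def by (rule exE)
  then have v: "v \<in> carrier_vec (length vs)" "v \<noteq> 0\<^sub>v (length vs)" "A *\<^sub>v v = ev \<cdot>\<^sub>v v"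
    by (simp_all add: eigenvector_def dimA)
  define h where "h x = v $ (THE i. i < length vs \<and> vs ! i = x)" for x
  have h: "h (vs ! i) = v $ i" if "i < length vs" for i
  proof -
    have "(THE j. j < length vs \<and> vs ! j = vs ! i) = i"
      using that nth_eq_iff_index_eq[OF vs(1)] by (intro the_equality) auto
    then show ?thesis by (simp add: h_def)
  qed
  have "\<exists>i<length vs. v $ i \<noteq> 0"
  proof (rule ccontr)
    assume "\<not> (\<exists>i<length vs. v $ i \<noteq> 0)"
    then have "v = 0\<^sub>v (length vs)" using v(1) by (intro eq_vecI) auto
    then show False using v(2) by simp
  qed
  then obtain i0 where i0: "i0 < length vs" "v $ i0 \<noteq> 0" by auto
  have eig: "sum h (nb x) = ev * h x" if "x \<in> V" for x
  proof -
    obtain i where i: "i < length vs" "vs ! i = x" using \<open>x \<in> V\<close>[folded vs(2)] by (auto simp: in_set_conv_nth)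
    have "ev * v $ i = (A *\<^sub>v v) $ i" using v i by simp
    also have "\<dots> = (\<Sum>j<length vs. (if (vs ! i, vs ! j) \<in> E then h (vs ! j) else 0))"
      using i(1) v(1) dimA h
      by (auto simp: scalar_prod_def lessThan_atLeast0 A_def adjacency_matrix_def intro!: sum.cong)
    also have "\<dots> = (\<Sum>y\<in>V. if (x, y) \<in> E then h y else 0)"
      unfolding i(2) by (rule sum_vs[of "\<lambda>y. if (x, y) \<in> E then h y else 0"])
    also have "\<dots> = sum h (nb x)" unfolding nb_def by (rule sum.inter_filter[OF finite_V, symmetric])
    finally show ?thesis using h[OF i(1)] i by simp
  qed
  show ?thesis using eigenfunction[OF eig vs_V[OF i0(1)]] h[OF i0(1)] i0(2) by simp
qed

text \<open>A diagonal entry counts closed walks at a vertex: loops, then edges, then edges together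
  with a triangle on them.\<close>

lemma adjacency_traces:
  defines "A \<equiv> adjacency_matrix X vs"
  shows "(\<Sum>i<n * r. (A ^\<^sub>m 1) $$ (i, i)) = 0"
    and "(\<Sum>i<n * r. (A ^\<^sub>m 2) $$ (i, i)) = real (n * r) * (real n - 1)"
    and "(\<Sum>i<n * r. (A ^\<^sub>m 3) $$ (i, i)) = real (n * r) * (real n - 1) * real a1"
proof -
  let ?N = "length vs"
  have A: "A \<in> carrier_mat ?N ?N" by (simp add: A_def adjacency_matrix_def)
  have entry: "A $$ (i, j) = (if (vs ! i, vs ! j) \<in> E then 1 else 0)" if "i < ?N" "j < ?N" for i j
    using that by (simp add: A_def adjacency_matrix_def)
  have prod: "(C * A) $$ (i, j) = (\<Sum>k<?N. C $$ (i, k) * A $$ (k, j))"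
    if "C \<in> carrier_mat ?N ?N" "i < ?N" "j < ?N" for C i j
    using A that by (simp add: scalar_prod_def lessThan_atLeast0)
  have A2: "(A * A) $$ (i, j) = card {z \<in> V. (vs ! i, z) \<in> E \<and> (z, vs ! j) \<in> E}"
    if "i < ?N" "j < ?N" for i j
  proof -
    have "(A * A) $$ (i, j) = (\<Sum>k<?N. A $$ (i, k) * A $$ (k, j))" by (rule prod[OF A that])
    also have "\<dots> = (\<Sum>k<?N. if (vs ! i, vs ! k) \<in> E \<and> (vs ! k, vs ! j) \<in> E then 1 else 0)"
      using that by (intro sum.cong) (auto simp: entry)
    also have "\<dots> = (\<Sum>z\<in>V. if (vs ! i, z) \<in> E \<and> (z, vs ! j) \<in> E then 1 else 0)"
      by (rule sum_vs[of "\<lambda>z. if (vs ! i, z) \<in> E \<and> (z, vs ! j) \<in> E then 1 else 0"])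
    finally show ?thesis using finite_V by (simp flip: sum.inter_filter)
  qed
  have A3: "(A * A * A) $$ (i, i) = (real n - 1) * real a1" if "i < ?N" for i
  proof -
    have "(A * A * A) $$ (i, i) = (\<Sum>k<?N. (A * A) $$ (i, k) * A $$ (k, i))"
      using A that by (intro prod) auto
    also have "\<dots> = (\<Sum>k<?N. if (vs ! i, vs ! k) \<in> E then real a1 else 0)"
    proof (intro sum.cong refl)
      fix k assume "k \<in> {..<?N}"
      then show "(A * A) $$ (i, k) * A $$ (k, i) = (if (vs ! i, vs ! k) \<in> E then real a1 else 0)"
        using A2[of i k] entry[of k i] a1[of "vs ! i" "vs ! k"] E_sym[of "vs ! k" "vs ! i"] that
        by (simp del: index_mult_mat)
    qed
    also have "\<dots> = (\<Sum>z\<in>V. if (vs ! i, z) \<in> E then real a1 else 0)"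
      by (rule sum_vs[of "\<lambda>z. if (vs ! i, z) \<in> E then real a1 else 0"])
    also have "\<dots> = real (card (nb (vs ! i))) * real a1"
      using finite_V by (simp add: nb_def flip: sum.inter_filter)
    finally show ?thesis using card_nb[OF vs_V[OF that]] n_ge_2 by (simp add: of_nat_diff)
  qed
  have pow: "A ^\<^sub>m 1 = A" "A ^\<^sub>m 2 = A * A" "A ^\<^sub>m 3 = A * A * A"
    using A by (simp_all add: numeral_2_eq_2 numeral_3_eq_3)
  show "(\<Sum>i<n * r. (A ^\<^sub>m 1) $$ (i, i)) = 0"
    unfolding pow length_vs[symmetric] using entry E_irrefl by (intro sum.neutral) auto
  have "(A * A) $$ (i, i) = real n - 1" if "i < ?N" for i
    using A2[OF that that] card_common_neighbours[OF vs_V[OF that] vs_V[OF that]] n_ge_2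
    by (simp add: of_nat_diff del: index_mult_mat)
  then show "(\<Sum>i<n * r. (A ^\<^sub>m 2) $$ (i, i)) = real (n * r) * (real n - 1)"
    unfolding pow length_vs[symmetric] by (simp del: index_mult_mat)
  show "(\<Sum>i<n * r. (A ^\<^sub>m 3) $$ (i, i)) = real (n * r) * (real n - 1) * real a1"
    unfolding pow length_vs[symmetric] using A3 by (simp del: index_mult_mat)
qed

lemma multiplicities:
  fixes \<theta> \<tau> :: real
  assumes spec: "spectrum (adjacency_matrix X vs) = {real n - 1, \<theta>, -1, \<tau>}"
    and order: "real n - 1 > \<theta>" "\<theta> > -1" "-1 > \<tau>"
  shows "\<theta> + \<tau> = real a1 - real c" and "\<theta> * \<tau> = - (real n - 1)"
    and "real (Polynomial.order \<theta> (char_poly (adjacency_matrix X vs))) =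
          real n * (real r - 1) * (- \<tau>) / (\<theta> - \<tau>)"
    and "real (Polynomial.order \<tau> (char_poly (adjacency_matrix X vs))) =
          real n * (real r - 1) * \<theta> / (\<theta> - \<tau>)"
proof -
  define A where "A = adjacency_matrix X vs"
  define N where "N = real n - 1"
  define \<delta> where "\<delta> = real a1 - real c"
  have A: "A \<in> carrier_mat (n * r) (n * r)"
    using length_vs by (simp add: A_def adjacency_matrix_def)
  interpret map_poly_hom: map_poly_inj_idom_hom "of_real :: real \<Rightarrow> complex" ..
  have quad: "ev\<^sup>2 = \<delta> * ev + N" if "ev \<in> {\<theta>, \<tau>}" for ev
  proof -
    have "eigenvalue A ev" using spec that unfolding A_def[symmetric] spectrum_def by blast
    then have "poly (char_poly A) ev = 0" using eigenvalue_root_char_poly[OF A] by simp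
    then have "poly (char_poly (map_mat complex_of_real A)) (of_real ev) = 0"
      by (simp add: of_real_hom.char_poly_hom[OF A])
    then have "eigenvalue (map_mat complex_of_real A) (of_real ev)"
      using eigenvalue_root_char_poly[of "map_mat complex_of_real A" "n * r"] A by simp
    from adjacency_eigenvalue[OF this[unfolded A_def]]
    have "complex_of_real ev = of_real N \<or> complex_of_real ev = of_real (-1) \<or>
        complex_of_real (ev\<^sup>2) = of_real (\<delta> * ev + N)"
      by (simp add: N_def \<delta>_def)
    then have "ev = N \<or> ev = -1 \<or> ev\<^sup>2 = \<delta> * ev + N" unfolding of_real_eq_iff .
    then show ?thesis using that order by (auto simp: N_def)
  qed
  then have q\<theta>: "\<theta>\<^sup>2 = \<delta> * \<theta> + N" and q\<tau>: "\<tau>\<^sup>2 = \<delta> * \<tau> + N" by auto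
  have ne: "\<theta> \<noteq> \<tau>" using order by simp
  \<comment> \<open>Distinct roots of one quadratic: Vieta gives their sum and product.\<close>
  have "(\<theta> - \<tau>) * (\<theta> + \<tau> - \<delta>) = 0" using q\<theta> q\<tau> by (simp add: algebra_simps power2_eq_square)
  then have sum: "\<theta> + \<tau> = \<delta>" using ne by simp
  then show "\<theta> + \<tau> = real a1 - real c" by (simp add: \<delta>_def)
  have "\<theta> * \<tau> = \<theta> * (\<delta> - \<theta>)" unfolding sum[symmetric] by simp
  also have "\<dots> = - N" using q\<theta> by (simp add: algebra_simps power2_eq_square)
  finally show prod: "\<theta> * \<tau> = - (real n - 1)" by (simp add: N_def)
  have real: "ev \<in> \<real>" if "eigenvalue (map_mat complex_of_real A) ev" for ev
  proof -
    from adjacency_eigenvalue[OF that[unfolded A_def]]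
    have "ev = of_real N \<or> ev = of_real (-1) \<or> ev\<^sup>2 = of_real \<delta> * ev + of_real N"
      by (simp add: N_def \<delta>_def)
    moreover have "ev\<^sup>2 - of_real \<delta> * ev - of_real N = (ev - of_real \<theta>) * (ev - of_real \<tau>)"
    proof -
      have "(ev - of_real \<theta>) * (ev - of_real \<tau>) = ev\<^sup>2 - of_real (\<theta> + \<tau>) * ev + of_real (\<theta> * \<tau>)"
        by (simp add: algebra_simps power2_eq_square)
      then show ?thesis unfolding sum prod N_def by simp
    qed
    ultimately have "ev = of_real N \<or> ev = of_real (-1) \<or> ev = of_real \<theta> \<or> ev = of_real \<tau>" by auto
    then show ?thesis by auto
  qed
  from char_poly_real_roots[OF A real] obtain es where
    es: "char_poly A = (\<Prod>e\<leftarrow>es. [:- e, 1:])" "length es = n * r"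
    and tr: "\<And>k. (\<Sum>i<n * r. (A ^\<^sub>m k) $$ (i, i)) = (\<Sum>e\<leftarrow>es. e ^ k)" by blast
  define S where "S = {N, \<theta>, -1, \<tau>}"
  have "set es \<subseteq> S"
  proof
    fix e assume "e \<in> set es"
    then have "poly (char_poly A) e = 0" unfolding es(1) by (rule linear_poly_root)
    then show "e \<in> S"
      using spectrum_root_char_poly[OF A] spec unfolding A_def[symmetric] S_def N_def by blast
  qed
  define m where "m e = real (count_list es e)" for e
  have cp: "(\<Sum>e\<leftarrow>es. e ^ k) = m N * N ^ k + m \<theta> * \<theta> ^ k + m (-1) * (-1) ^ k + m \<tau> * \<tau> ^ k" for k
    unfolding sum_list_eq_sum_count[OF _ \<open>set es \<subseteq> S\<close>, of "\<lambda>e. e ^ k", unfolded S_def, simplified]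
    using order by (simp add: m_def N_def)
  have t0: "m N + m \<theta> + m (-1) + m \<tau> = (N + 1) * real r"
    using cp[of 0] es(2) by (simp add: N_def sum_list_triv)
  have t1: "m N * N + m \<theta> * \<theta> - m (-1) + m \<tau> * \<tau> = 0"
    using cp[of 1] tr[of 1] adjacency_traces(1) by (simp add: A_def)
  have t2: "m N * N\<^sup>2 + m \<theta> * \<theta>\<^sup>2 + m (-1) + m \<tau> * \<tau>\<^sup>2 = (N + 1) * real r * N"
    using cp[of 2] tr[of 2] adjacency_traces(2) by (simp add: A_def N_def)
  have t3: "m N * N ^ 3 + m \<theta> * \<theta> ^ 3 - m (-1) + m \<tau> * \<tau> ^ 3 = (N + 1) * real r * N * real a1"
    using cp[of 3] tr[of 3] adjacency_traces(3) by (simp add: A_def N_def)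
  have Npar: "N = 1 + real a1 + (real r - 1) * real c"
    using parameters r_ge_2 by (simp add: N_def of_nat_diff)
  have pos: "N > 0" "real c > 0" "real r > 0" using n_ge_2 c_ge_1 r_ge_2 by (auto simp: N_def)
  note mult = multiplicities_from_traces[OF pos \<delta>_def Npar q\<theta> q\<tau> ne t0 t1 t2 t3]
  have m: "real (Polynomial.order e (char_poly A)) = m e" for e
    unfolding es(1) m_def by (simp add: order_prod_linear)
  show "real (Polynomial.order \<theta> (char_poly (adjacency_matrix X vs))) =
          real n * (real r - 1) * (- \<tau>) / (\<theta> - \<tau>)"
    unfolding A_def[symmetric] m mult(1) by (simp add: N_def)
  show "real (Polynomial.order \<tau> (char_poly (adjacency_matrix X vs))) =
          real n * (real r - 1) * \<theta> / (\<theta> - \<tau>)"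
    unfolding A_def[symmetric] m mult(2) by (simp add: N_def)
qed

end

end

section \<open>Arc functions and characters\<close>

text \<open>A digraph isomorphism maps vertices and arcs separately. Arcs are pairs with ends
  \<open>fst\<close> and \<open>snd\<close> on both sides, so the vertex map determines the arc map;
  with \<open>wf\<close>, its injectivity reflects arcs.\<close>

lemma pair_graph_isoE:
  assumes "digraph_iso (with_proj Y) (with_proj X)" and wf: "parcs Y \<subseteq> pverts Y \<times> pverts Y"
  obtains \<phi> where "bij_betw \<phi> (pverts Y) (pverts X)"
    and "\<And>x y. x \<in> pverts Y \<Longrightarrow> y \<in> pverts Y \<Longrightarrow> (\<phi> x, \<phi> y) \<in> parcs X \<longleftrightarrow> (x, y) \<in> parcs Y"
proof -
  obtain hom where hom: "pre_digraph.digraph_isomorphism (with_proj Y) hom"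
    and X: "with_proj X = app_iso hom (with_proj Y)"
    using assms(1) unfolding digraph_iso_def by (elim exE conjE)
  define \<phi> where "\<phi> = iso_verts hom"
  have inj: "inj_on \<phi> (pverts Y)"
    and ends: "\<And>a. a \<in> parcs Y \<Longrightarrow> \<phi> (fst a) = iso_tail hom (iso_arcs hom a) \<and> \<phi> (snd a) = iso_head hom (iso_arcs hom a)"
    using hom unfolding pre_digraph.digraph_isomorphism_def by (auto simp: \<phi>_def)
  have V: "pverts X = \<phi> ` pverts Y" and E: "parcs X = iso_arcs hom ` parcs Y"
    and "iso_tail hom = fst" "iso_head hom = snd"
    using arg_cong[OF X, of verts] arg_cong[OF X, of arcs] arg_cong[OF X, of tail]
      arg_cong[OF X, of head] by (simp_all add: \<phi>_def)
  then have arc: "iso_arcs hom a = (\<phi> (fst a), \<phi> (snd a))" if "a \<in> parcs Y" for a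
    using ends[OF that] by simp
  show thesis
  proof (rule that[of \<phi>])
    show "bij_betw \<phi> (pverts Y) (pverts X)" using inj V by (simp add: bij_betw_def)
    fix x y assume xy: "x \<in> pverts Y" "y \<in> pverts Y"
    show "(\<phi> x, \<phi> y) \<in> parcs X \<longleftrightarrow> (x, y) \<in> parcs Y"
    proof
      assume "(\<phi> x, \<phi> y) \<in> parcs X"
      then obtain a where a: "a \<in> parcs Y" "(\<phi> x, \<phi> y) = iso_arcs hom a" using E by auto
      then have "\<phi> x = \<phi> (fst a)" "\<phi> y = \<phi> (snd a)" using arc by simp_all
      moreover have "fst a \<in> pverts Y" "snd a \<in> pverts Y" using wf a(1) by auto
      ultimately have "x = fst a" "y = snd a" using inj_onD[OF inj] xy by blast+
      then show "(x, y) \<in> parcs Y" using a(1) by simp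
    next
      assume xy: "(x, y) \<in> parcs Y"
      then have "iso_arcs hom (x, y) = (\<phi> x, \<phi> y)" using arc[OF xy] by simp
      then show "(\<phi> x, \<phi> y) \<in> parcs X" unfolding E by (metis xy imageI)
    qed
  qed
qed

section \<open>The regular group and products along paths\<close>

locale arc_cover_graph = drackn_graph +
  fixes f :: "nat \<Rightarrow> nat \<Rightarrow> nat \<Rightarrow> nat"
  assumes arc: "arc_function n r f"
    and iso: "digraph_iso (with_proj (arc_cover n r f)) (with_proj X)"
    and reg: "acts_regularly (arc_group n r f) r"
    and comm: "comm_group (arc_group n r f)"
begin

abbreviation "G \<equiv> arc_group n r f"
abbreviation "Y \<equiv> arc_cover n r f"

sublocale G: comm_group G by (rule comm)

lemma G_mult: "x \<otimes>\<^bsub>G\<^esub> y = x \<circ> y" and G_one: "\<one>\<^bsub>G\<^esub> = id"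
  by (simp_all add: arc_group_def subgroup_generated_def sym_group_def)

lemma arc_values:
  assumes "u \<in> {1..n}" "v \<in> {1..n}" "u \<noteq> v"
  shows "f u v \<in> carrier (sym_group r)" "f v u = inv\<^bsub>sym_group r\<^esub> (f u v)"
  using arc assms unfolding arc_function_def by blast+

lemma permutes_f:
  assumes "u \<in> {1..n}" "v \<in> {1..n}" "u \<noteq> v"
  shows "f u v permutes {1..r}"
  using arc_values(1)[OF assms] by (simp add: sym_group_carrier)

lemma f_inverse:
  assumes "u \<in> {1..n}" "v \<in> {1..n}" "u \<noteq> v"
  shows "f v u \<circ> f u v = id"
proof -
  interpret S: group "sym_group r" by (rule sym_group_is_group)
  have "f v u \<otimes>\<^bsub>sym_group r\<^esub> f u v = \<one>\<^bsub>sym_group r\<^esub>"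
    unfolding arc_values(2)[OF assms] using arc_values(1)[OF assms] by (rule S.l_inv)
  then show ?thesis by (simp add: sym_group_mult sym_group_one)
qed

lemma f_in_G:
  assumes "u \<in> {1..n}" "v \<in> {1..n}" "u \<noteq> v"
  shows "f u v \<in> carrier G"
proof -
  show ?thesis
    unfolding arc_group_def carrier_subgroup_generated
    by (intro generate.incl IntI arc_values(1)[OF assms]) (use assms in blast)
qed

lemma G_permutes: "g \<in> carrier G \<Longrightarrow> g permutes {1..r}"
  using subsetD[OF group.carrier_subgroup_generated_subset[OF sym_group_is_group]]
  unfolding arc_group_def sym_group_carrier[symmetric] by blast

text \<open>Only the identity fixes a point, so the image of one point determines a group element.
  This turns counts of points into counts of elements.\<close>

lemma G_eqI:
  assumes g: "g \<in> carrier G" and h: "h \<in> carrier G" and i: "i \<in> {1..r}" and eq: "g i = h i"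
  shows "g = h"
proof -
  define k where "k = inv\<^bsub>G\<^esub> h \<otimes>\<^bsub>G\<^esub> g"
  have k: "k \<in> carrier G" using g h by (simp add: k_def)
  have "(inv\<^bsub>G\<^esub> h \<otimes>\<^bsub>G\<^esub> h) i = i" using h by (simp add: G_one)
  then have "k i = i" using eq by (simp add: k_def G_mult)
  then have "k = \<one>\<^bsub>G\<^esub>" using reg k i unfolding acts_regularly_def by blast
  then show ?thesis using g h unfolding k_def by (metis G.inv_solve_left G.one_closed G.r_one)
qed

lemma order_G: "order G = r" and finite_G: "finite (carrier G)"
proof -
  have 1: "1 \<in> {1..r}" using r_ge_2 by simp
  have "inj_on (\<lambda>g. g 1) (carrier G)" using G_eqI[OF _ _ 1] by (intro inj_onI)
  moreover have "(\<lambda>g. g 1) ` carrier G = {1..r}"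
  proof
    show "(\<lambda>g. g 1) ` carrier G \<subseteq> {1..r}" using permutes_in_image[OF G_permutes] 1 by blast
    show "{1..r} \<subseteq> (\<lambda>g. g 1) ` carrier G"
    proof
      fix j assume "j \<in> {1..r}"
      then obtain g where "g \<in> carrier G" "g 1 = j" using reg 1 unfolding acts_regularly_def by blast
      then show "j \<in> (\<lambda>g. g 1) ` carrier G" by blast
    qed
  qed
  ultimately have bij: "bij_betw (\<lambda>g. g 1) (carrier G) {1..r}" by (simp add: bij_betw_def)
  show "order G = r" unfolding order_def using bij_betw_same_card[OF bij] by simp
  show "finite (carrier G)" using bij_betw_finite[OF bij] by simp
qed

text \<open>A path of length two is determined by its middle fibre \<open>w\<close>, since the
  matching dictates the point in it. The case \<open>u = v\<close> serves to recognize antipodal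
  classes.\<close>

lemma arc_cover_common:
  assumes "u \<in> {1..n}" "v \<in> {1..n}" "i \<in> {1..r}" "j \<in> {1..r}"
  shows "card {z \<in> pverts Y. ((u, i), z) \<in> parcs Y \<and> (z, (v, j)) \<in> parcs Y} =
    card {w \<in> {1..n} - {u, v}. (f w v \<circ> f u w) i = j}"
proof -
  have im: "f u w i \<in> {1..r}" if "w \<in> {1..n} - {u}" for w
    using permutes_in_image[OF permutes_f[OF assms(1), of w]] that assms(3) by simp
  have "bij_betw (\<lambda>w. (w, f u w i)) {w \<in> {1..n} - {u, v}. (f w v \<circ> f u w) i = j}
      {z \<in> pverts Y. ((u, i), z) \<in> parcs Y \<and> (z, (v, j)) \<in> parcs Y}"
    unfolding bij_betw_def
  proof
    show "inj_on (\<lambda>w. (w, f u w i)) {w \<in> {1..n} - {u, v}. (f w v \<circ> f u w) i = j}"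
      by (rule inj_onI) simp
    show "(\<lambda>w. (w, f u w i)) ` {w \<in> {1..n} - {u, v}. (f w v \<circ> f u w) i = j} =
        {z \<in> pverts Y. ((u, i), z) \<in> parcs Y \<and> (z, (v, j)) \<in> parcs Y}"
    proof (rule Set.set_eqI)
      fix z :: "nat \<times> nat"
      obtain w k where z: "z = (w, k)" by (cases z)
      have "z \<in> {z \<in> pverts Y. ((u, i), z) \<in> parcs Y \<and> (z, (v, j)) \<in> parcs Y} \<longleftrightarrow>
          w \<in> {1..n} - {u, v} \<and> k \<in> {1..r} \<and> k = f u w i \<and> f w v k = j"
        using assms by (simp add: arc_cover_def z) blast
      also have "\<dots> \<longleftrightarrow> w \<in> {1..n} - {u, v} \<and> k = f u w i \<and> f w v k = j"
        using im[of w] by blast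
      also have "\<dots> \<longleftrightarrow> z \<in> (\<lambda>w. (w, f u w i)) ` {w \<in> {1..n} - {u, v}. (f w v \<circ> f u w) i = j}"
        unfolding z image_iff by auto
      finally show "z \<in> (\<lambda>w. (w, f u w i)) ` {w \<in> {1..n} - {u, v}. (f w v \<circ> f u w) i = j} \<longleftrightarrow>
          z \<in> {z \<in> pverts Y. ((u, i), z) \<in> parcs Y \<and> (z, (v, j)) \<in> parcs Y}" by (rule sym)
    qed
  qed
  from bij_betw_same_card[OF this] show ?thesis by simp
qed

text \<open>These products correspond to the common neighbours of \<open>(u, i)\<close> and
  \<open>(v, g i)\<close>, which are adjacent exactly when \<open>g = f u v\<close>.\<close>

lemma arc_products:
  assumes u: "u \<in> {1..n}" and v: "v \<in> {1..n}" and "u \<noteq> v" and g: "g \<in> carrier G"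
  shows "card {w \<in> {1..n} - {u, v}. f w v \<circ> f u w = g} = (if g = f u v then a1 else c)"
proof -
  have "parcs Y \<subseteq> pverts Y \<times> pverts Y" by (auto simp: arc_cover_def)
  from pair_graph_isoE[OF iso this] obtain \<phi> where bij: "bij_betw \<phi> (pverts Y) V"
    and \<phi>: "\<And>x y. x \<in> pverts Y \<Longrightarrow> y \<in> pverts Y \<Longrightarrow> (\<phi> x, \<phi> y) \<in> E \<longleftrightarrow> (x, y) \<in> parcs Y"
    by blast
  have VY: "pverts Y = {1..n} \<times> {1..r}" by (simp add: arc_cover_def)
  have \<phi>V: "\<phi> x \<in> V" if "x \<in> pverts Y" for x using bij that by (rule bij_betw_apply)
  have inj: "inj_on \<phi> (pverts Y)" using bij by (rule bij_betw_imp_inj_on)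
  have common: "card {z \<in> V. (\<phi> x, z) \<in> E \<and> (z, \<phi> y) \<in> E} =
      card {z \<in> pverts Y. (x, z) \<in> parcs Y \<and> (z, y) \<in> parcs Y}"
    if xy: "x \<in> pverts Y" "y \<in> pverts Y" for x y
  proof -
    have "{z \<in> V. (\<phi> x, z) \<in> E \<and> (z, \<phi> y) \<in> E} =
        \<phi> ` {z \<in> pverts Y. (x, z) \<in> parcs Y \<and> (z, y) \<in> parcs Y}"
      unfolding bij_betw_imp_surj_on[OF bij, symmetric] using \<phi>[OF xy(1)] \<phi>[OF _ xy(2)] by blast
    moreover have "inj_on \<phi> {z \<in> pverts Y. (x, z) \<in> parcs Y \<and> (z, y) \<in> parcs Y}"
      using inj by (rule inj_on_subset) auto
    ultimately show ?thesis by (simp add: card_image)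
  qed
  obtain i where i: "i \<in> {1..r}" using r_ge_2 by fastforce
  \<comment> \<open>The isomorphism is not assumed to respect fibres. Two points of one fibre of
    \<open>Y\<close> are nonadjacent and, as opposite arcs carry inverse permutations, have no
    common neighbour; c \<ge> 1 then forces them to be antipodal. Both sets have \<open>r\<close>
    elements.\<close>
  have fibre: "cls (\<phi> (u, i)) = \<phi> ` ({u} \<times> {1..r})"
  proof -
    have uY: "(u, i) \<in> pverts Y" using u i VY by simp
    have "\<phi> (u, j) \<in> cls (\<phi> (u, i))" if j: "j \<in> {1..r}" for j
    proof (cases "j = i")
      case True
      then show ?thesis using in_cls[OF \<phi>V[OF uY]] by simp
    next
      case False
      have jY: "(u, j) \<in> pverts Y" using u j VY by simp
      have ne: "\<phi> (u, i) \<noteq> \<phi> (u, j)" using inj_onD[OF inj _ uY jY] False by auto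
      have nadj: "(\<phi> (u, i), \<phi> (u, j)) \<notin> E" using \<phi>[OF uY jY] by (simp add: arc_cover_def)
      have "{w \<in> {1..n} - {u, u}. (f w u \<circ> f u w) i = j} = {}"
      proof -
        have "(f w u \<circ> f u w) i = i" if "w \<in> {1..n} - {u, u}" for w
          using f_inverse[OF u, of w] that by simp
        then show ?thesis using False by auto
      qed
      then have "card {z \<in> V. (\<phi> (u, i), z) \<in> E \<and> (z, \<phi> (u, j)) \<in> E} = 0"
        unfolding common[OF uY jY] arc_cover_common[OF u u i j] by (simp only: card.empty)
      then show ?thesis
        using card_common_neighbours[OF \<phi>V[OF uY] \<phi>V[OF jY]] ne nadj c_ge_1 by (auto split: if_splits)
    qed
    then have sub: "\<phi> ` ({u} \<times> {1..r}) \<subseteq> cls (\<phi> (u, i))" by auto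
    have "card (\<phi> ` ({u} \<times> {1..r})) = card ({u} \<times> {1..r})"
      using u VY by (intro card_image inj_on_subset[OF inj]) auto
    also have "\<dots> = card (cls (\<phi> (u, i)))"
      using cover(3)[OF cls_in_F[OF \<phi>V[OF uY]]] by simp
    finally show ?thesis
      using card_subset_eq[OF finite_subset[OF F_subset[OF cls_in_F[OF \<phi>V[OF uY]]] finite_V] sub] by simp
  qed
  define j where "j = g i"
  have j: "j \<in> {1..r}" using permutes_in_image[OF G_permutes[OF g]] i by (simp add: j_def)
  have Y: "(u, i) \<in> pverts Y" "(v, j) \<in> pverts Y" using u v i j VY by auto
  have "{w \<in> {1..n} - {u, v}. f w v \<circ> f u w = g} = {w \<in> {1..n} - {u, v}. (f w v \<circ> f u w) i = j}"
  proof (intro Collect_cong conj_cong refl)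
    fix w assume w: "w \<in> {1..n} - {u, v}"
    have "f w v \<circ> f u w \<in> carrier G"
      using G.m_closed[OF f_in_G[of w v] f_in_G[of u w]] u v w by (simp add: G_mult)
    then show "f w v \<circ> f u w = g \<longleftrightarrow> (f w v \<circ> f u w) i = j"
      using G_eqI[OF _ g i] unfolding j_def by metis
  qed
  then have "card {w \<in> {1..n} - {u, v}. f w v \<circ> f u w = g} =
      card {z \<in> V. (\<phi> (u, i), z) \<in> E \<and> (z, \<phi> (v, j)) \<in> E}"
    unfolding common[OF Y] arc_cover_common[OF u v i j] by simp
  also have "\<dots> = (if (\<phi> (u, i), \<phi> (v, j)) \<in> E then a1 else c)"
  proof -
    have "\<phi> (u, i) \<noteq> \<phi> (v, j)" using inj_onD[OF inj _ Y] \<open>u \<noteq> v\<close> by auto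
    moreover have "\<phi> (v, j) \<notin> \<phi> ` ({u} \<times> {1..r})"
    proof
      assume "\<phi> (v, j) \<in> \<phi> ` ({u} \<times> {1..r})"
      then obtain k where "k \<in> {1..r}" "\<phi> (v, j) = \<phi> (u, k)" by auto
      then have "(v, j) = (u, k)" using u VY by (intro inj_onD[OF inj _ Y(2)]) auto
      then show False using \<open>u \<noteq> v\<close> by simp
    qed
    ultimately show ?thesis
      using card_common_neighbours[OF \<phi>V[OF Y(1)] \<phi>V[OF Y(2)]] unfolding fibre by simp
  qed
  also have "(\<phi> (u, i), \<phi> (v, j)) \<in> E \<longleftrightarrow> f u v i = g i"
    using \<phi>[OF Y] u v \<open>u \<noteq> v\<close> i j by (auto simp: arc_cover_def j_def)
  also have "\<dots> \<longleftrightarrow> g = f u v"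
    using G_eqI[OF g f_in_G[OF u v \<open>u \<noteq> v\<close>] i] by metis
  finally show ?thesis .
qed

text \<open>
  Applying a nontrivial character \<open>\<chi>\<close> of the group to the arc function: the relation
  \<open>\<Sum>\<^sub>g \<chi> g = 0\<close> turns the counts of products along paths of length two into a quadratic
  equation for the resulting Hermitian matrix.
\<close>
lemma character_matrix:
  assumes p: "prime p" "p dvd r"
  obtains B :: "nat \<Rightarrow> nat \<Rightarrow> complex"
  where "\<And>u. B u u = 0"
    and "\<And>u v. u \<in> {1..n} \<Longrightarrow> v \<in> {1..n} \<Longrightarrow> B v u = cnj (B u v)"
    and "\<And>u v. u \<noteq> v \<Longrightarrow> cmod (B u v) = 1"
    and "\<And>u v. u \<in> {1..n} \<Longrightarrow> v \<in> {1..n} \<Longrightarrow> (\<Sum>w\<in>{1..n}. B u w * B w v) =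
      (if u = v then of_real (real n - 1) else 0) + of_real (real a1 - real c) * B u v"
    and "\<And>u v. p = 2 \<Longrightarrow> B u v \<in> \<real>"
proof -
  have "p dvd order G" using p(2) order_G by simp
  obtain \<chi> where mult: "\<And>x y. x \<in> carrier G \<Longrightarrow> y \<in> carrier G \<Longrightarrow> \<chi> (x \<otimes>\<^bsub>G\<^esub> y) = \<chi> x * \<chi> y"
    and root: "\<And>x. \<chi> x ^ p = (1 :: complex)" and nontriv: "\<exists>x\<in>carrier G. \<chi> x \<noteq> 1"
    by (fact G.prime_order_character[OF finite_G p(1) \<open>p dvd order G\<close>])
  note mult = mult[unfolded G_mult]
  have p0: "p > 0" using p(1) by (rule prime_gt_0_nat)
  have norm: "cmod (\<chi> x) = 1" for x
    using arg_cong[OF root[of x], of cmod] p0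
    by (intro power_eq_imp_eq_base[of "cmod (\<chi> x)" p 1]) (simp_all add: norm_power)
  have nz: "\<chi> x \<noteq> 0" for x using norm[of x] by auto
  have one: "\<chi> id = 1"
    using mult[OF G.one_closed G.one_closed] nz[of id] by (simp add: G_one)
  have sum0: "(\<Sum>g\<in>carrier G. \<chi> g) = 0"
  proof -
    obtain x where x: "x \<in> carrier G" "\<chi> x \<noteq> 1" using nontriv by blast
    \<comment> \<open>Translation by \<open>x\<close> permutes the group and multiplies the sum by
      \<chi> x, which is not 1.\<close>
    have "bij_betw (\<lambda>g. x \<circ> g) (carrier G) (carrier G)"
      unfolding bij_betw_def using G.inj_on_multc G.surj_const_mult[OF x(1)] G.inj_on_cmult[OF x(1)]
      by (simp add: G_mult)
    from sum.reindex_bij_betw[OF this, of \<chi>]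
    have "(\<Sum>g\<in>carrier G. \<chi> g) = \<chi> x * (\<Sum>g\<in>carrier G. \<chi> g)"
      unfolding sum_distrib_left using mult[OF x(1)] by simp
    then have "(1 - \<chi> x) * (\<Sum>g\<in>carrier G. \<chi> g) = 0" by (simp add: left_diff_distrib)
    then show ?thesis using x(2) by simp
  qed
  define B where "B u v = (if u = v then 0 else \<chi> (f u v))" for u v
  have inv: "\<chi> (f v u) * \<chi> (f u v) = 1" if "u \<in> {1..n}" "v \<in> {1..n}" "u \<noteq> v" for u v
    using mult[OF f_in_G[of v u] f_in_G[of u v]] f_inverse[OF that] that one by simp
  show thesis
  proof (rule that[of B])
    show "B u u = 0" for u by (simp add: B_def)
    show "cmod (B u v) = 1" if "u \<noteq> v" for u v using that norm by (simp add: B_def)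
    show "B v u = cnj (B u v)" if uv: "u \<in> {1..n}" "v \<in> {1..n}" for u v
    proof (cases "u = v")
      case False
      have "\<chi> (f u v) * cnj (\<chi> (f u v)) = 1" using norm[of "f u v"] by (simp add: complex_norm_square[symmetric])
      then have "\<chi> (f v u) * \<chi> (f u v) = cnj (\<chi> (f u v)) * \<chi> (f u v)"
        using inv[OF uv False] by (simp add: mult.commute)
      then show ?thesis using False nz by (simp add: B_def)
    qed (simp add: B_def)
    show "B u v \<in> \<real>" if "p = 2" for u v
    proof -
      have "\<chi> x = 1 \<or> \<chi> x = -1" for x using root[of x] that by (simp add: power2_eq_1_iff)
      then show ?thesis unfolding B_def by (metis Reals_0 Reals_1 Reals_minus)
    qed
    show "(\<Sum>w\<in>{1..n}. B u w * B w v) =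
      (if u = v then of_real (real n - 1) else 0) + of_real (real a1 - real c) * B u v"
      if uv: "u \<in> {1..n}" "v \<in> {1..n}" for u v
    proof (cases "u = v")
      case True
      have "(\<Sum>w\<in>{1..n}. B u w * B w v) = (\<Sum>w\<in>{1..n} - {u}. B u w * B w v)"
        using uv by (intro sum.mono_neutral_right) (auto simp: B_def)
      also have "\<dots> = (\<Sum>w\<in>{1..n} - {u}. 1)"
        using inv[of _ u] uv True by (intro sum.cong) (auto simp: B_def)
      also have "\<dots> = of_real (real n - 1)" using uv by (simp add: of_nat_diff)
      finally show ?thesis using True by (simp add: B_def)
    next
      case False
      let ?W = "{1..n} - {u, v}"
      have in_G: "f w v \<circ> f u w \<in> carrier G" if "w \<in> ?W" for w
        using G.m_closed[OF f_in_G[of w v] f_in_G[of u w]] uv that by (simp add: G_mult)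
      have "(\<Sum>w\<in>{1..n}. B u w * B w v) = (\<Sum>w\<in>?W. B u w * B w v)"
        by (intro sum.mono_neutral_right) (auto simp: B_def)
      also have "\<dots> = (\<Sum>w\<in>?W. \<chi> (f w v \<circ> f u w))"
        using uv mult[OF f_in_G f_in_G] by (intro sum.cong) (auto simp: B_def mult.commute)
      also have "\<dots> = (\<Sum>g\<in>carrier G. \<Sum>w\<in>{w \<in> ?W. f w v \<circ> f u w = g}. \<chi> (f w v \<circ> f u w))"
        by (rule sum.group[symmetric, OF _ finite_G]) (use in_G in blast)+
      also have "\<dots> = (\<Sum>g\<in>carrier G. of_nat (if g = f u v then a1 else c) * \<chi> g)"
        using arc_products[OF uv False] by (intro sum.cong) auto
      also have "\<dots> = (\<Sum>g\<in>carrier G. (if g = f u v then (of_nat a1 - of_nat c) * \<chi> g else 0) + of_nat c * \<chi> g)"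
        by (intro sum.cong) (auto simp: algebra_simps)
      also have "\<dots> = (of_nat a1 - of_nat c) * \<chi> (f u v) + of_nat c * (\<Sum>g\<in>carrier G. \<chi> g)"
        using finite_G f_in_G[OF uv False] by (simp add: sum.distrib sum_distrib_left)
      finally show ?thesis using False sum0 by (simp add: B_def)
    qed
  qed
qed

end

section \<open>The bounds\<close>

lemma real_choose_Suc_2: "real (Suc d choose 2) = ((real d)\<^sup>2 + real d) / 2"
  by (induction d) (simp_all add: numeral_2_eq_2 field_simps)

text \<open>
  Here and in the complex analogue, \<open>d = n \<phi> / (\<phi> + \<psi>)\<close> is the dimension belonging to the pair of
  eigenvalues with \<open>\<phi> \<psi> = n - 1\<close>, so that \<open>d = n \<phi>\<^sup>2 / (\<phi>\<^sup>2 + n - 1)\<close>.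
\<close>
lemma absolute_bound_real_iff:
  fixes x d \<phi> \<psi> :: real
  assumes x: "x > 1" and \<phi>: "\<phi> > 0" and d: "d = x * \<phi> / (\<phi> + \<psi>)" and prod: "\<phi> * \<psi> = x - 1"
  defines "s \<equiv> sqrt (8 * x + 1)"
  shows "x \<le> (d\<^sup>2 + d) / 2 \<longleftrightarrow> (s + 3) / 2 \<le> \<phi>\<^sup>2"
    and "x = (d\<^sup>2 + d) / 2 \<longleftrightarrow> (s + 3) / 2 = \<phi>\<^sup>2"
proof -
  have s2: "s\<^sup>2 = 8 * x + 1" using x by (simp add: s_def)
  have "sqrt (3\<^sup>2) < s" unfolding s_def using x by (subst real_sqrt_less_iff) simp
  then have s3: "s > 3" by simp
  have xs: "x = (s\<^sup>2 - 1) / 8" using s2 by simp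
  have "\<phi> * \<psi> > 0" using prod x by simp
  then have "\<psi> > 0" using \<phi> by (simp add: zero_less_mult_iff)
  then have "d > 0" using d x \<phi> by simp
  have "d * (\<phi> + \<psi>) = x * \<phi>" using d \<phi> \<open>\<psi> > 0\<close> by simp
  moreover have "\<phi>\<^sup>2 + x - 1 = (\<phi> + \<psi>) * \<phi>" using prod by (simp add: algebra_simps power2_eq_square)
  ultimately have dq: "d * (\<phi>\<^sup>2 + x - 1) = x * \<phi>\<^sup>2"
    by (simp add: power2_eq_square flip: mult.assoc)
  \<comment> \<open>\<open>(s - 1) / 2\<close> is the positive root of z^2 + z = 2 x, the origin of
    \<open>sqrt (8 * x + 1)\<close>. The dimension reaches it exactly when \<phi>^2 reaches
    \<open>(s + 3) / 2\<close>.\<close>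
  have "(d - (s - 1) / 2) * (\<phi>\<^sup>2 + x - 1) = x * \<phi>\<^sup>2 - (s - 1) / 2 * (\<phi>\<^sup>2 + x - 1)"
    using dq by (simp add: left_diff_distrib)
  also have "\<dots> = (s - 1) * (s - 3) / 8 * (\<phi>\<^sup>2 - (s + 3) / 2)"
    unfolding xs by (simp add: field_simps power2_eq_square)
  finally have key: "(d - (s - 1) / 2) * (\<phi>\<^sup>2 + x - 1) = (s - 1) * (s - 3) / 8 * (\<phi>\<^sup>2 - (s + 3) / 2)" .
  have factor: "(d\<^sup>2 + d) / 2 - x = (d - (s - 1) / 2) * ((d + (s + 1) / 2) / 2)"
    unfolding xs by (simp add: field_simps power2_eq_square)
  have "\<phi>\<^sup>2 + x - 1 > 0" using x zero_le_power2[of \<phi>] by linarith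
  then have pos: "\<phi>\<^sup>2 + x - 1 > 0" "(s - 1) * (s - 3) / 8 > 0" "(d + (s + 1) / 2) / 2 > 0"
    using s3 \<open>d > 0\<close> by (simp_all add: add_pos_pos)
  have "x \<le> (d\<^sup>2 + d) / 2 \<longleftrightarrow> 0 \<le> (d\<^sup>2 + d) / 2 - x" by simp
  also have "\<dots> \<longleftrightarrow> 0 \<le> d - (s - 1) / 2"
    unfolding factor using pos(3) by (simp add: zero_le_mult_iff)
  also have "\<dots> \<longleftrightarrow> 0 \<le> (d - (s - 1) / 2) * (\<phi>\<^sup>2 + x - 1)"
    using pos(1) by (simp only: zero_le_mult_iff) auto
  also have "\<dots> \<longleftrightarrow> 0 \<le> \<phi>\<^sup>2 - (s + 3) / 2"
    unfolding key using pos(2) by (simp only: zero_le_mult_iff) auto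
  finally show "x \<le> (d\<^sup>2 + d) / 2 \<longleftrightarrow> (s + 3) / 2 \<le> \<phi>\<^sup>2" by simp
  have "x = (d\<^sup>2 + d) / 2 \<longleftrightarrow> (d\<^sup>2 + d) / 2 - x = 0" by auto
  also have "\<dots> \<longleftrightarrow> d - (s - 1) / 2 = 0"
    unfolding factor using pos(3) by (simp only: mult_eq_0_iff) auto
  also have "\<dots> \<longleftrightarrow> (d - (s - 1) / 2) * (\<phi>\<^sup>2 + x - 1) = 0"
    using pos(1) by (simp only: mult_eq_0_iff) auto
  also have "\<dots> \<longleftrightarrow> \<phi>\<^sup>2 - (s + 3) / 2 = 0"
    unfolding key using pos(2) by (simp only: mult_eq_0_iff) auto
  finally show "x = (d\<^sup>2 + d) / 2 \<longleftrightarrow> (s + 3) / 2 = \<phi>\<^sup>2" by auto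
qed

lemma absolute_bound_complex_iff:
  fixes x d \<phi> \<psi> :: real
  assumes x: "x > 1" and \<phi>: "\<phi> > 0" and d: "d = x * \<phi> / (\<phi> + \<psi>)" and prod: "\<phi> * \<psi> = x - 1"
  shows "x \<le> d\<^sup>2 \<longleftrightarrow> sqrt x + 1 \<le> \<phi>\<^sup>2"
    and "x = d\<^sup>2 \<longleftrightarrow> sqrt x + 1 = \<phi>\<^sup>2"
proof -
  define k where "k = sqrt x"
  have xk: "x = k\<^sup>2" and k: "k > 1" using x by (simp_all add: k_def)
  have "\<phi> * \<psi> > 0" using prod x by simp
  then have "\<psi> > 0" using \<phi> by (simp add: zero_less_mult_iff)
  then have "d > 0" using d x \<phi> by simp
  have "d * (\<phi> + \<psi>) = x * \<phi>" using d \<phi> \<open>\<psi> > 0\<close> by simp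
  moreover have "\<phi>\<^sup>2 + x - 1 = (\<phi> + \<psi>) * \<phi>" using prod by (simp add: algebra_simps power2_eq_square)
  ultimately have dq: "d * (\<phi>\<^sup>2 + x - 1) = x * \<phi>\<^sup>2"
    by (simp add: power2_eq_square flip: mult.assoc)
  \<comment> \<open>The dimension is now compared with \<open>k\<close>, the positive root of z^2 =
    x, which corresponds to \<phi>^2 = k + 1.\<close>
  have "(d - k) * (\<phi>\<^sup>2 + x - 1) = x * \<phi>\<^sup>2 - k * (\<phi>\<^sup>2 + x - 1)"
    using dq by (simp add: left_diff_distrib)
  also have "\<dots> = k * (k - 1) * (\<phi>\<^sup>2 - (k + 1))"
    unfolding xk by (simp add: algebra_simps power2_eq_square)
  finally have key: "(d - k) * (\<phi>\<^sup>2 + x - 1) = k * (k - 1) * (\<phi>\<^sup>2 - (k + 1))" .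
  have "\<phi>\<^sup>2 + x - 1 > 0" using x zero_le_power2[of \<phi>] by linarith
  then have pos: "\<phi>\<^sup>2 + x - 1 > 0" "k * (k - 1) > 0" using k by simp_all
  have "x \<le> d\<^sup>2 \<longleftrightarrow> 0 \<le> d - k"
    unfolding xk using \<open>d > 0\<close> k by simp
  also have "\<dots> \<longleftrightarrow> 0 \<le> (d - k) * (\<phi>\<^sup>2 + x - 1)"
    using pos(1) by (simp only: zero_le_mult_iff) auto
  also have "\<dots> \<longleftrightarrow> 0 \<le> \<phi>\<^sup>2 - (k + 1)"
    unfolding key using pos(2) by (simp only: zero_le_mult_iff[of "k * (k - 1)"]) simp
  finally show "x \<le> d\<^sup>2 \<longleftrightarrow> sqrt x + 1 \<le> \<phi>\<^sup>2" by (simp add: k_def)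
  have "x = d\<^sup>2 \<longleftrightarrow> d - k = 0"
    unfolding xk using \<open>d > 0\<close> k by auto
  also have "\<dots> \<longleftrightarrow> (d - k) * (\<phi>\<^sup>2 + x - 1) = 0"
    using pos(1) by (simp only: mult_eq_0_iff) auto
  also have "\<dots> \<longleftrightarrow> \<phi>\<^sup>2 - (k + 1) = 0"
    unfolding key using pos(2) by (simp only: mult_eq_0_iff[of "k * (k - 1)"]) auto
  finally show "x = d\<^sup>2 \<longleftrightarrow> sqrt x + 1 = \<phi>\<^sup>2" by (auto simp: k_def)
qed

text \<open>The bounds on \<open>\<theta>\<close> translate into lower bounds on \<open>\<tau> = -t\<close> through \<open>\<theta> t = n - 1\<close>.\<close>
lemma lower_bound_iff:
  fixes x t \<theta> a b :: real
  assumes "t > 0" and prod: "\<theta> * t = x - 1" and "a > 0" and ab: "a * b = (x - 1)\<^sup>2"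
  shows "- sqrt b \<le> - t \<longleftrightarrow> a \<le> \<theta>\<^sup>2" and "- t = - sqrt b \<longleftrightarrow> a = \<theta>\<^sup>2"
proof -
  have eq: "a * b = \<theta>\<^sup>2 * t\<^sup>2" unfolding ab prod[symmetric] by (rule power_mult_distrib)
  have t2: "t\<^sup>2 > 0" using \<open>t > 0\<close> by simp
  have root: "t = sqrt (t\<^sup>2)" using \<open>t > 0\<close> by simp
  have "- sqrt b \<le> - t \<longleftrightarrow> t\<^sup>2 \<le> b" by (subst root) (simp only: neg_le_iff_le real_sqrt_le_iff)
  also have "\<dots> \<longleftrightarrow> a * t\<^sup>2 \<le> \<theta>\<^sup>2 * t\<^sup>2" unfolding eq[symmetric] using \<open>a > 0\<close> by simp
  also have "\<dots> \<longleftrightarrow> a \<le> \<theta>\<^sup>2" using t2 by simp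
  finally show "- sqrt b \<le> - t \<longleftrightarrow> a \<le> \<theta>\<^sup>2" .
  have "- t = - sqrt b \<longleftrightarrow> t\<^sup>2 = b" by (subst root) (simp only: neg_equal_iff_equal real_sqrt_eq_iff)
  also have "\<dots> \<longleftrightarrow> a * t\<^sup>2 = \<theta>\<^sup>2 * t\<^sup>2" unfolding eq[symmetric] using \<open>a > 0\<close> by simp
  also have "\<dots> \<longleftrightarrow> a = \<theta>\<^sup>2" using t2 by simp
  finally show "- t = - sqrt b \<longleftrightarrow> a = \<theta>\<^sup>2" .
qed

lemma upper_bound_iff:
  fixes t a :: real
  assumes "t > 0"
  shows "- t \<le> - sqrt a \<longleftrightarrow> a \<le> t\<^sup>2" and "- t = - sqrt a \<longleftrightarrow> a = t\<^sup>2"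
proof -
  have root: "t = sqrt (t\<^sup>2)" using assms by simp
  show "- t \<le> - sqrt a \<longleftrightarrow> a \<le> t\<^sup>2"
    by (subst root) (simp only: neg_le_iff_le real_sqrt_le_iff)
  have "- t = - sqrt a \<longleftrightarrow> t\<^sup>2 = a"
    by (subst root) (simp only: neg_equal_iff_equal real_sqrt_eq_iff)
  then show "- t = - sqrt a \<longleftrightarrow> a = t\<^sup>2" by auto
qed

theorem lemma6p4:
  fixes X :: "'a pair_pre_digraph" and vs :: "'a list"
    and n r c :: nat and \<theta> \<tau> mbar_\<theta> mbar_\<tau> :: real
  assumes "abelian_drackn n r c X"
    and "distinct vs" and "set vs = pverts X"
    and "spectrum (adjacency_matrix X vs) = {real n - 1, \<theta>, -1, \<tau>}"
    and "real n - 1 > \<theta>" and "\<theta> > -1" and "-1 > \<tau>"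
    and "mbar_\<theta> = real (Polynomial.order \<theta> (char_poly (adjacency_matrix X vs))) / (real r - 1)"
    and "mbar_\<tau> = real (Polynomial.order \<tau> (char_poly (adjacency_matrix X vs))) / (real r - 1)"
  shows
    "(even r \<longrightarrow>
        (\<not> (r = 2 \<and> n = c + 2) \<longrightarrow>
           - (1/2) * sqrt ((real n - 1) * (sqrt (8 * real n + 1) - 3)) \<le> \<tau>) \<and>
        \<tau> \<le> - sqrt (1/2 * (sqrt (8 * real n + 1) + 3)) \<and>
        (\<tau> = - (1/2) * sqrt ((real n - 1) * (sqrt (8 * real n + 1) - 3)) \<longrightarrow>
           (\<exists>d :: nat. real d = mbar_\<tau> \<and>
              (\<exists>L :: real vec set set. equiangular_lines d L \<and> card L = (d + 1) choose 2))) \<and>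
        (\<tau> = - sqrt (1/2 * (sqrt (8 * real n + 1) + 3)) \<longrightarrow>
           (\<exists>d :: nat. real d = mbar_\<theta> \<and>
              (\<exists>L :: real vec set set. equiangular_lines d L \<and> card L = (d + 1) choose 2)))) \<and>
     (odd r \<longrightarrow>
        - (sqrt (real n) - 1) * sqrt (sqrt (real n) + 1) \<le> \<tau> \<and>
        \<tau> \<le> - sqrt (sqrt (real n) + 1) \<and>
        (\<tau> = - (sqrt (real n) - 1) * sqrt (sqrt (real n) + 1) \<longrightarrow>
           (\<exists>d :: nat. real d = mbar_\<tau> \<and>
              (\<exists>L :: complex vec set set. equiangular_lines d L \<and> card L = d ^ 2))) \<and>
        (\<tau> = - sqrt (sqrt (real n) + 1) \<longrightarrow>
           (\<exists>d :: nat. real d = mbar_\<theta> \<and>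
              (\<exists>L :: complex vec set set. equiangular_lines d L \<and> card L = d ^ 2))))"
proof -
  obtain f where "drackn n r c X" "arc_function n r f"
    "digraph_iso (with_proj (arc_cover n r f)) (with_proj X)"
    "acts_regularly (arc_group n r f) r" "comm_group (arc_group n r f)"
    using assms(1) unfolding abelian_drackn_def by (elim conjE exE)
  then interpret arc_cover_graph n r c X f
    by (intro arc_cover_graph.intro drackn_graph.intro arc_cover_graph_axioms.intro)
  note mult = multiplicities[OF assms(2-7)]
  define t where "t = - \<tau>"
  define x where "x = real n"
  have t: "t > 1" using assms(7) by (simp add: t_def)
  have x: "x > 1" using n_ge_2 by (simp add: x_def)
  have prod: "\<theta> * t = x - 1" and diff: "\<theta> - t = real a1 - real c"
    using mult(1,2) by (simp_all add: t_def x_def)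
  have "\<theta> * t > 0" using prod x by simp
  then have "\<theta> > 0" using t by (simp add: zero_less_mult_iff)
  have par: "x = real a1 + (real r - 1) * real c + 2"
    using parameters r_ge_2 by (simp add: x_def of_nat_diff)
  have m\<theta>: "mbar_\<theta> = x * t / (t + \<theta>)" and m\<tau>: "mbar_\<tau> = x * \<theta> / (\<theta> + t)"
    using mult(3,4) assms(8,9) r_ge_2 by (simp_all add: t_def x_def add.commute)
  \<comment> \<open>This decides whether \<theta> exceeds 1: the right side vanishes only for r = 2
    and a1 = 0, that is, n = c + 2.\<close>
  have eq: "(\<theta> - 1) * (1 + t) = 2 * real a1 + (real r - 2) * real c"
    using prod diff par by (simp add: algebra_simps)
  have pos: "2 * real a1 + (real r - 2) * real c > 0" if "\<not> (r = 2 \<and> n = c + 2)"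
  proof (cases "r = 2")
    case True
    then have "a1 > 0" using that parameters by auto
    then show ?thesis using True by simp
  next
    case False
    then show ?thesis using r_ge_2 c_ge_1 by (simp add: add_nonneg_pos)
  qed
  have \<theta>1: "\<theta> > 1" if "\<not> (r = 2 \<and> n = c + 2)"
  proof -
    have "(\<theta> - 1) * (1 + t) > 0" using pos[OF that] eq by simp
    then show ?thesis using t by (simp add: zero_less_mult_iff)
  qed
  \<comment> \<open>Order 2 for even \<open>r\<close> makes the entries of \<open>B\<close>
    real.\<close>
  define p where "p = (if even r then 2 else (SOME p. prime p \<and> p dvd r))"
  have "\<exists>p. prime p \<and> p dvd r" using r_ge_2 prime_factor_nat[of r] by auto
  from someI_ex[OF this] have p: "prime p" "p dvd r" by (auto simp: p_def)
  obtain B :: "nat \<Rightarrow> nat \<Rightarrow> complex"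
    where B0: "\<And>u. B u u = 0"
      and herm: "\<And>u v. u \<in> {1..n} \<Longrightarrow> v \<in> {1..n} \<Longrightarrow> B v u = cnj (B u v)"
      and unim: "\<And>u v. u \<noteq> v \<Longrightarrow> cmod (B u v) = 1"
      and quad: "\<And>u v. u \<in> {1..n} \<Longrightarrow> v \<in> {1..n} \<Longrightarrow> (\<Sum>w\<in>{1..n}. B u w * B w v) =
        (if u = v then of_real (real n - 1) else 0) + of_real (real a1 - real c) * B u v"
      and Breal: "\<And>u v. p = 2 \<Longrightarrow> B u v \<in> \<real>"
    by (fact character_matrix[OF p])
  have Breal: "B u v \<in> \<real>" if "even r" for u v using Breal that by (simp add: p_def)
  have fin: "finite {1..n}" and card: "real (card {1..n}) = x" by (simp_all add: x_def)
  have quad1: "(\<Sum>w\<in>{1..n}. B u w * B w v) =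
        (if u = v then of_real (t * \<theta>) else 0) + of_real (\<theta> - t) * B u v"
    if "u \<in> {1..n}" "v \<in> {1..n}" for u v
    using quad[OF that] prod diff by (simp add: x_def mult.commute)
  \<comment> \<open>Here \<phi> is \<open>t\<close>, so the Gram matrix is a multiple of
    \<open>B - \<tau> I\<close> and its rank is the dimension for \<theta>.\<close>
  obtain d1 :: nat where d1: "real d1 = mbar_\<theta>" "card {1..n} \<le> d1\<^sup>2"
      "\<exists>L :: complex vec set set. equiangular_lines d1 L \<and> card L = card {1..n}"
    and d1r: "even r \<Longrightarrow> card {1..n} \<le> Suc d1 choose 2"
      "even r \<Longrightarrow> \<exists>L :: real vec set set. equiangular_lines d1 L \<and> card L = card {1..n}"
    by (rule equiangular_of_two_eigenvalues[OF fin t \<open>\<theta> > 0\<close> B0 herm unim quad1])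
      (use m\<theta> card Breal in simp_all)
  have t0: "t > 0" using t by simp
  \<comment> \<open>Negating \<open>B\<close> exchanges \<theta> and \<open>t\<close>, so the same
    construction gives the lines for \<tau>.\<close>
  have quad2: "(\<Sum>w\<in>{1..n}. - B u w * - B w v) =
        (if u = v then of_real (\<theta> * t) else 0) + of_real (t - \<theta>) * - B u v"
    if "u \<in> {1..n}" "v \<in> {1..n}" for u v
    using quad1[OF that] by (simp add: algebra_simps)
  have ex_d2: "\<exists>d2 :: nat. real d2 = mbar_\<tau> \<and> card {1..n} \<le> d2\<^sup>2 \<and>
      (\<exists>L :: complex vec set set. equiangular_lines d2 L \<and> card L = card {1..n}) \<and>
      (even r \<longrightarrow> card {1..n} \<le> Suc d2 choose 2) \<and>
      (even r \<longrightarrow> (\<exists>L :: real vec set set. equiangular_lines d2 L \<and> card L = card {1..n}))"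
    if "\<theta> > 1"
  proof (rule equiangular_of_two_eigenvalues[of "{1..n}" \<theta> t "\<lambda>u v. - B u v", OF fin that t0 _ _ _ quad2])
    show "- B u u = 0" for u using B0 by simp
    show "- B v u = cnj (- B u v)" if "u \<in> {1..n}" "v \<in> {1..n}" for u v using herm[OF that] by simp
    show "cmod (- B u v) = 1" if "u \<noteq> v" for u v using unim[OF that] by simp
  qed (use m\<tau> card Breal in auto)
  let ?s = "sqrt (8 * x + 1)"
  note real1 = absolute_bound_real_iff[OF x t0 m\<theta>, unfolded mult.commute[of t], OF prod]
  note real2 = absolute_bound_real_iff[OF x \<open>\<theta> > 0\<close> m\<tau> prod]
  note complex1 = absolute_bound_complex_iff[OF x t0 m\<theta>, unfolded mult.commute[of t], OF prod]
  note complex2 = absolute_bound_complex_iff[OF x \<open>\<theta> > 0\<close> m\<tau> prod]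
  have choose: "card {1..n} \<le> Suc d choose 2 \<longleftrightarrow> x \<le> ((real d)\<^sup>2 + real d) / 2"
    "card {1..n} = Suc d choose 2 \<longleftrightarrow> x = ((real d)\<^sup>2 + real d) / 2" for d
    unfolding real_choose_Suc_2[symmetric] x_def by simp_all
  have square: "card {1..n} \<le> d\<^sup>2 \<longleftrightarrow> x \<le> (real d)\<^sup>2" "card {1..n} = d\<^sup>2 \<longleftrightarrow> x = (real d)\<^sup>2" for d
    unfolding of_nat_power[symmetric] x_def by (simp_all del: of_nat_power)
  have s: "?s > 3"
  proof -
    have "sqrt (3\<^sup>2) < ?s" using x by (subst real_sqrt_less_iff) simp
    then show ?thesis by simp
  qed
  have s2: "?s\<^sup>2 = 8 * x + 1" using x by simp
  have half: "- (1/2) * sqrt ((x - 1) * (?s - 3)) = - sqrt ((x - 1) * (?s - 3) / 4)"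
    by (simp add: real_sqrt_divide)
  \<comment> \<open>Because \<theta> t = x - 1, a lower bound a on \<theta>^2 is the upper bound (x
    - 1)^2 / a on t^2; the conjugate factor \<open>?s - 3\<close> clears the denominator, as
    \<open>?s^2 - 9 = 8 (x - 1)\<close>.\<close>
  have "(?s + 3) / 2 * ((x - 1) * (?s - 3) / 4) = (x - 1) * (?s\<^sup>2 - 9) / 8"
    by (simp add: field_simps power2_eq_square)
  also have "\<dots> = (x - 1)\<^sup>2" unfolding s2 by (simp add: power2_eq_square)
  finally have "(?s + 3) / 2 * ((x - 1) * (?s - 3) / 4) = (x - 1)\<^sup>2" .
  from lower_bound_iff[OF t0 prod _ this]
  have low_real: "- (1/2) * sqrt ((x - 1) * (?s - 3)) \<le> \<tau> \<longleftrightarrow> (?s + 3) / 2 \<le> \<theta>\<^sup>2"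
    "\<tau> = - (1/2) * sqrt ((x - 1) * (?s - 3)) \<longleftrightarrow> (?s + 3) / 2 = \<theta>\<^sup>2"
    unfolding half using s by (simp_all add: t_def)
  have up_real: "\<tau> \<le> - sqrt (1/2 * (?s + 3)) \<longleftrightarrow> (?s + 3) / 2 \<le> t\<^sup>2"
    "\<tau> = - sqrt (1/2 * (?s + 3)) \<longleftrightarrow> (?s + 3) / 2 = t\<^sup>2"
    using upper_bound_iff[OF t0, of "(?s + 3) / 2"] s by (simp_all add: t_def)
  define k where "k = sqrt x"
  have k: "k > 1" and xk: "x = k\<^sup>2" using x by (simp_all add: k_def)
  have root: "- (k - 1) * sqrt (k + 1) = - sqrt ((k - 1)\<^sup>2 * (k + 1))"
    using k by (simp add: real_sqrt_mult left_diff_distrib)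
  have "(k + 1) * ((k - 1)\<^sup>2 * (k + 1)) = (x - 1)\<^sup>2"
    unfolding xk by (simp add: algebra_simps power2_eq_square)
  from lower_bound_iff[OF t0 prod _ this]
  have low_complex: "- (k - 1) * sqrt (k + 1) \<le> \<tau> \<longleftrightarrow> k + 1 \<le> \<theta>\<^sup>2"
    "\<tau> = - (k - 1) * sqrt (k + 1) \<longleftrightarrow> k + 1 = \<theta>\<^sup>2"
    unfolding root using k by (simp_all add: t_def)
  have up_complex: "\<tau> \<le> - sqrt (k + 1) \<longleftrightarrow> k + 1 \<le> t\<^sup>2" "\<tau> = - sqrt (k + 1) \<longleftrightarrow> k + 1 = t\<^sup>2"
    using upper_bound_iff[OF t0, of "k + 1"] k by (simp_all add: t_def)
  \<comment> \<open>A tight lower bound makes \<theta>^2 equal to a number above 3, so the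
    exceptional case cannot be tight and the lines exist without a proviso.\<close>
  have \<theta>1_tight: "\<theta> > 1" if "(?s + 3) / 2 = \<theta>\<^sup>2"
  proof (rule power2_less_imp_less[of 1])
    show "1\<^sup>2 < \<theta>\<^sup>2" unfolding that[symmetric] using s by simp
  qed (use \<open>\<theta> > 0\<close> in simp)
  have "(\<not> (r = 2 \<and> n = c + 2) \<longrightarrow> - (1/2) * sqrt ((x - 1) * (?s - 3)) \<le> \<tau>) \<and>
      \<tau> \<le> - sqrt (1/2 * (?s + 3)) \<and>
      (\<tau> = - (1/2) * sqrt ((x - 1) * (?s - 3)) \<longrightarrow>
         (\<exists>d :: nat. real d = mbar_\<tau> \<and>
            (\<exists>L :: real vec set set. equiangular_lines d L \<and> card L = (d + 1) choose 2))) \<and>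
      (\<tau> = - sqrt (1/2 * (?s + 3)) \<longrightarrow>
         (\<exists>d :: nat. real d = mbar_\<theta> \<and>
            (\<exists>L :: real vec set set. equiangular_lines d L \<and> card L = (d + 1) choose 2)))"
    if r: "even r"
  proof (intro conjI impI)
    assume "\<not> (r = 2 \<and> n = c + 2)"
    then obtain d :: nat where "real d = mbar_\<tau>" "card {1..n} \<le> Suc d choose 2"
      using ex_d2[OF \<theta>1] r by blast
    then show "- (1/2) * sqrt ((x - 1) * (?s - 3)) \<le> \<tau>"
      unfolding low_real real2(1)[symmetric] by (simp only: choose)
  next
    show "\<tau> \<le> - sqrt (1/2 * (?s + 3))"
      using d1r(1)[OF r] d1(1) unfolding up_real real1(1)[symmetric] by (simp only: choose)
  next
    assume "\<tau> = - (1/2) * sqrt ((x - 1) * (?s - 3))"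
    then have tight: "(?s + 3) / 2 = \<theta>\<^sup>2" by (simp only: low_real)
    obtain d :: nat where d: "real d = mbar_\<tau>"
      "\<exists>L :: real vec set set. equiangular_lines d L \<and> card L = card {1..n}"
      using ex_d2[OF \<theta>1_tight[OF tight]] r by blast
    have "card {1..n} = Suc d choose 2" using tight unfolding real2(2)[symmetric] d(1)[symmetric] by (simp only: choose)
    then show "\<exists>d :: nat. real d = mbar_\<tau> \<and>
            (\<exists>L :: real vec set set. equiangular_lines d L \<and> card L = (d + 1) choose 2)"
      using d by (intro exI[of _ d]) (simp only: Suc_eq_plus1)
  next
    assume "\<tau> = - sqrt (1/2 * (?s + 3))"
    then have "(?s + 3) / 2 = t\<^sup>2" by (simp only: up_real)
    then have "card {1..n} = Suc d1 choose 2" unfolding real1(2)[symmetric] d1(1)[symmetric] by (simp only: choose)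
    then show "\<exists>d :: nat. real d = mbar_\<theta> \<and>
            (\<exists>L :: real vec set set. equiangular_lines d L \<and> card L = (d + 1) choose 2)"
      using d1(1) d1r(2)[OF r] by (intro exI[of _ d1]) (simp only: Suc_eq_plus1)
  qed
  moreover have "- (k - 1) * sqrt (k + 1) \<le> \<tau> \<and> \<tau> \<le> - sqrt (k + 1) \<and>
      (\<tau> = - (k - 1) * sqrt (k + 1) \<longrightarrow>
         (\<exists>d :: nat. real d = mbar_\<tau> \<and>
            (\<exists>L :: complex vec set set. equiangular_lines d L \<and> card L = d ^ 2))) \<and>
      (\<tau> = - sqrt (k + 1) \<longrightarrow>
         (\<exists>d :: nat. real d = mbar_\<theta> \<and>
            (\<exists>L :: complex vec set set. equiangular_lines d L \<and> card L = d ^ 2)))"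
    if r: "odd r"
  proof -
    have "\<not> (r = 2 \<and> n = c + 2)" using r by auto
    then obtain d2 :: nat where d2: "real d2 = mbar_\<tau>" "card {1..n} \<le> d2\<^sup>2"
      "\<exists>L :: complex vec set set. equiangular_lines d2 L \<and> card L = card {1..n}"
      using ex_d2[OF \<theta>1] by blast
    show ?thesis
    proof (intro conjI impI)
      show "- (k - 1) * sqrt (k + 1) \<le> \<tau>"
        using d2(1,2) unfolding low_complex unfolding k_def complex2(1)[symmetric] by (simp only: square)
      show "\<tau> \<le> - sqrt (k + 1)"
        using d1(1,2) unfolding up_complex unfolding k_def complex1(1)[symmetric] by (simp only: square)
    next
      assume "\<tau> = - (k - 1) * sqrt (k + 1)"
      then have "k + 1 = \<theta>\<^sup>2" by (simp only: low_complex)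
      then have "card {1..n} = d2\<^sup>2"
        unfolding k_def complex2(2)[symmetric] d2(1)[symmetric] by (simp only: square)
      then show "\<exists>d :: nat. real d = mbar_\<tau> \<and>
            (\<exists>L :: complex vec set set. equiangular_lines d L \<and> card L = d ^ 2)"
        using d2(1,3) by (intro exI[of _ d2]) simp
    next
      assume "\<tau> = - sqrt (k + 1)"
      then have "k + 1 = t\<^sup>2" by (simp only: up_complex)
      then have "card {1..n} = d1\<^sup>2"
        unfolding k_def complex1(2)[symmetric] d1(1)[symmetric] by (simp only: square)
      then show "\<exists>d :: nat. real d = mbar_\<theta> \<and>
            (\<exists>L :: complex vec set set. equiangular_lines d L \<and> card L = d ^ 2)"
        using d1(1,3) by (intro exI[of _ d1]) simp
    qed
  qed
  ultimately show ?thesis unfolding k_def x_def by blast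
qed

end
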